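(* Consider the robust batched kernelized bandit setting on a finite domain $\mathcal{X}\subseteq[0,1]^d$ with time horizon $T$, and let $a\in(0,1)$ be a parameter. Use the pre-specified batch sizes $$N_i=\min\Bigl\{\lceil T^{1-a^i}\rceil,\;T-\sum_{j=1}^{i-1}N_j\Bigr\},\qquad i=1,\dots,B,$$ where $B$ is the exact number of batches needed (the smallest integer with $\sum_{i=1}^B N_i=T$). For any $\delta\in(0,1)$ let $\Lambda=\Psi+\sqrt{\log(|\mathcal{X}|/\delta)}$. Then, for every $f$ with $\|f\|_k\le\Psi$: (1) If $k$ is the SE kernel or the Mat\'ern kernel and $a\in(\tfrac12,1)$, the robust-BPE algorithm run with these batch sizes yields, with probability at least $1-\delta$, $$R_{\xi,T}=O\Bigl(\bigl(\Lambda+\sqrt{\log\log\log T}\bigr)\sqrt{T\gamma_T}\Bigr).$$ (2) If $k$ is the Mat\'ern kernel with smoothness $\nu$ and $a\in(\tfrac{\nu}{2\nu+d},\tfrac12]$, the robust-BPE algorithm run with these batch sizes yields, with probability at least $1-\delta$, $$R_{\xi,T}=O\Bigl(\bigl(\Lambda+\sqrt{\log\log\log T}\bigr)\sqrt{T\overline{\gamma}_T}\Bigr),$$ where $(\overline{\gamma}_t)_{t\ge1}$ is any sequence that (i) satisfies $\overline{\gamma}_t\ge\gamma_t$ for all sufficiently large $t$, and (ii) has the form $\overline{\gamma}_t=c'\,t^{\frac{d}{2\nu+d}}\alpha_t$ for some non-decreasing sequence $(\alpha_t)_{t\ge1}$ and constant $c'>0$.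
   Context: Robust setting. An unknown function $f:\mathcal{X}\to\mathbb{R}$, $\mathcal{X}\subseteq[0,1]^d$ finite, lies in the RKHS of kernel $k$ with $\|f\|_k\le\Psi$. Kernels: $k_{\rm SE}(x,x')=\exp\bigl(-\frac{\|x-x'\|^2}{2l^2}\bigr)$, or $k_{\text{Mat\'ern}}(x,x')=\frac{2^{1-\nu}}{\Gamma(\nu)}\bigl(\frac{\sqrt{2\nu}\|x-x'\|}{l}\bigr)^{\nu}J_\nu\bigl(\frac{\sqrt{2\nu}\|x-x'\|}{l}\bigr)$ with $J_\nu$ the modified Bessel function (of the second kind), $l,\nu>0$; in particular $k(x,x)\le1$. A known function $\mathrm{dist}:\mathcal{X}\times\mathcal{X}\to\mathbb{R}$ and a constant $\xi$ are given; $\Delta_\xi(x)=\{x'-x:x'\in\mathcal{X},\ \mathrm{dist}(x,x')\le\xi\}$, assumed nonempty for all $x\in\mathcal{X}$ so that the minima below are defined. A $\xi$-robust optimal point is $x^*\in\arg\max_{x\in\mathcal{X}}\min_{\delta\in\Delta_\xi(x)}f(x+\delta)$. At each time $t\in\{1,\dots,T\}$ the algorithm chooses $x_t\in\mathcal{X}$ and $\delta_t\in\Delta_\xi(x_t)$, generating $y_t=f(x_t+\delta_t)+z_t$ with $z_t\sim N(0,\sigma^2)$ independent. Time is split into $B$ consecutive batches of sizes $N_1,\dots,N_B\ge1$; observations in a batch are revealed only at the end of the batch. The $\xi$-regret is $r_\xi(x)=\min_{\delta\in\Delta_\xi(x^* )}f(x^*+\delta)-\min_{\delta\in\Delta_\xi(x)}f(x+\delta)$,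 and $R_{\xi,T}=\sum_{t=1}^Tr_\xi(x_t)$. Maximum information gain: $\gamma_t=\max I(f_A;y_A)$ over collections $A=(x_1,\dots,x_t)$ of $t$ points of $\mathcal{X}$ (repetitions allowed), computed under $f\sim GP(0,k)$ with $N(0,\sigma^2)$ noise, i.e. $I(f_A;y_A)=\frac12\log\det(\mathbf{I}+\sigma^{-2}[k(x_r,x_s)]_{r,s})$. GP posterior. Given query points $x_1,\dots,x_t$ with observations $\mathbf{y}_t$, put $\mathbf{k}_t(x)=[k(x_r,x)]_{r=1}^t$, $\mathbf{K}_t=[k(x_r,x_s)]_{r,s}$, $\mu_t(x)=\mathbf{k}_t(x)^T(\mathbf{K}_t+\sigma^2\mathbf{I})^{-1}\mathbf{y}_t$, $\sigma_t(x)^2=k(x,x)-\mathbf{k}_t(x)^T(\mathbf{K}_t+\sigma^2\mathbf{I})^{-1}\mathbf{k}_t(x)$. Robust-BPE algorithm. Set $\mathcal{X}_1=\mathcal{X}$, $\beta=\bigl(\Psi+\sqrt{2\log\frac{|\mathcal{X}|B}{\delta}}\bigr)^2$. For each batch $i=1,\dots,B$: let $\mathcal{X}_{\xi,i}=\bigcup_{x\in\mathcal{X}_i}\{x+\delta:\delta\in\Delta_\xi(x)\}$. For $j=1,\dots,N_i$, the $j$-th query point of the batch is a maximizer over $\mathcal{X}_{\xi,i}$ of $\sigma^i_{j-1}$, the posterior standard deviation computed from only the first $j-1$ query points of batch $i$ ($\sigma^i_0(x)=\sqrt{k(x,x)}$); this query point is written as $x_t+\delta_t$ with $x_t\in\mathcal{X}_i$,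 $\delta_t\in\Delta_\xi(x_t)$. At the end of the batch, compute the posterior mean $\mu^i$ and standard deviation $\sigma^i$ from only the $N_i$ points of batch $i$; set $\mathrm{UCB}_i=\mu^i+\sqrt\beta\,\sigma^i$, $\mathrm{LCB}_i=\mu^i-\sqrt\beta\,\sigma^i$, and $\mathcal{X}_{i+1}=\{x\in\mathcal{X}_i:\min_{\delta\in\Delta_\xi(x)}\mathrm{UCB}_i(x+\delta)\ge\max_{x'\in\mathcal{X}_i}\min_{\delta\in\Delta_\xi(x')}\mathrm{LCB}_i(x'+\delta)\}$. Asymptotics: $T\to\infty$ with $d,\nu,l,\Psi,\sigma,\xi,a$ fixed constants (as is the sequence $(\overline\gamma_t)$ in part (2)); implied constants do not depend on $T,\delta,\mathcal{X},f$. *)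

theory Defs
  imports
    "HOL-Probability.Probability"
    "Jordan_Normal_Form.Determinant"
    "Jordan_Normal_Form.Gauss_Jordan_Elimination"
begin

subsection \<open>Kernels\<close>

definition se_kernel :: "real \<Rightarrow> 'a::real_normed_vector \<Rightarrow> 'a \<Rightarrow> real" where
  "se_kernel l x x' = exp (- (norm (x - x'))\<^sup>2 / (2 * l\<^sup>2))"

text \<open>Modified Bessel function of the second kind, real order and argument \<open>z > 0\<close>,
  by its standard integral representation.\<close>

definition bessel_K :: "real \<Rightarrow> real \<Rightarrow> real" where
  "bessel_K \<nu> z = integral {0..} (\<lambda>t. exp (- z * cosh t) * cosh (\<nu> * t))"

text \<open>On the diagonal the defining product has the form \<open>0 \<cdot> \<infinity>\<close>; as usual, the kernel takes its
  limit value \<open>1\<close> there.\<close>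

definition matern_kernel :: "real \<Rightarrow> real \<Rightarrow> 'a::real_normed_vector \<Rightarrow> 'a \<Rightarrow> real" where
  "matern_kernel \<nu> l x x' =
     (if x = x' then 1
      else 2 powr (1 - \<nu>) / Gamma \<nu>
             * (sqrt (2 * \<nu>) * norm (x - x') / l) powr \<nu>
             * bessel_K \<nu> (sqrt (2 * \<nu>) * norm (x - x') / l))"


subsection \<open>Reproducing kernel Hilbert spaces\<close>

text \<open>A Hilbert space \<open>H\<close> of real functions on \<open>X\<close> with inner product \<open>ip\<close> and reproducing
  kernel \<open>k\<close>. A function on \<open>X\<close> is represented by its extension by zero. Such a pair
  \<open>(H, ip)\<close> is unique on \<open>H\<close> if it exists, and exists iff \<open>k\<close> is symmetric and positive
  semidefinite on \<open>X\<close>.\<close>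

definition on_set :: "'a set \<Rightarrow> ('a \<Rightarrow> real) \<Rightarrow> 'a \<Rightarrow> real" where
  "on_set X g = (\<lambda>v. if v \<in> X then g v else 0)"

locale rkhs =
  fixes X :: "'a set"
    and k :: "'a \<Rightarrow> 'a \<Rightarrow> real"
    and H :: "('a \<Rightarrow> real) set"
    and ip :: "('a \<Rightarrow> real) \<Rightarrow> ('a \<Rightarrow> real) \<Rightarrow> real"
  assumes supported: "\<And>g. g \<in> H \<Longrightarrow> on_set X g = g"
    and zero_mem: "(\<lambda>_. 0) \<in> H"
    and add_mem: "\<And>g h. g \<in> H \<Longrightarrow> h \<in> H \<Longrightarrow> (\<lambda>v. g v + h v) \<in> H"
    and scale_mem: "\<And>c g. g \<in> H \<Longrightarrow> (\<lambda>v. c * g v) \<in> H"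
    and ip_sym: "\<And>g h. g \<in> H \<Longrightarrow> h \<in> H \<Longrightarrow> ip g h = ip h g"
    and ip_add: "\<And>g h w. g \<in> H \<Longrightarrow> h \<in> H \<Longrightarrow> w \<in> H \<Longrightarrow> ip (\<lambda>v. g v + h v) w = ip g w + ip h w"
    and ip_scale: "\<And>c g h. g \<in> H \<Longrightarrow> h \<in> H \<Longrightarrow> ip (\<lambda>v. c * g v) h = c * ip g h"
    and ip_nonneg: "\<And>g. g \<in> H \<Longrightarrow> 0 \<le> ip g g"
    and ip_definite: "\<And>g. g \<in> H \<Longrightarrow> ip g g = 0 \<Longrightarrow> g = (\<lambda>_. 0)"
    and complete:
      "\<And>s :: nat \<Rightarrow> 'a \<Rightarrow> real.
         (\<And>n. s n \<in> H) \<Longrightarrow>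
         (\<And>e. e > 0 \<Longrightarrow> \<exists>N. \<forall>m\<ge>N. \<forall>n\<ge>N.
              sqrt (ip (\<lambda>v. s m v - s n v) (\<lambda>v. s m v - s n v)) < e) \<Longrightarrow>
         \<exists>g\<in>H. (\<lambda>n. sqrt (ip (\<lambda>v. s n v - g v) (\<lambda>v. s n v - g v))) \<longlonglongrightarrow> 0"
    and kernel_mem: "\<And>x. x \<in> X \<Longrightarrow> on_set X (k x) \<in> H"
    and reproducing: "\<And>g x. g \<in> H \<Longrightarrow> x \<in> X \<Longrightarrow> ip g (on_set X (k x)) = g x"

definition rkhs_norm_le :: "'a set \<Rightarrow> ('a \<Rightarrow> 'a \<Rightarrow> real) \<Rightarrow> ('a \<Rightarrow> real) \<Rightarrow> real \<Rightarrow> bool" where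
  "rkhs_norm_le X k f \<Psi> \<longleftrightarrow>
     (\<exists>H ip. rkhs X k H ip \<and> on_set X f \<in> H \<and> sqrt (ip (on_set X f) (on_set X f)) \<le> \<Psi>)"


subsection \<open>Information gain and Gaussian process posterior\<close>

definition kernel_mat :: "('a \<Rightarrow> 'a \<Rightarrow> real) \<Rightarrow> 'a list \<Rightarrow> real mat" where
  "kernel_mat k qs = mat (length qs) (length qs) (\<lambda>(r, s). k (qs ! r) (qs ! s))"

definition kernel_vec :: "('a \<Rightarrow> 'a \<Rightarrow> real) \<Rightarrow> 'a list \<Rightarrow> 'a \<Rightarrow> real Matrix.vec" where
  "kernel_vec k qs x = Matrix.vec (length qs) (\<lambda>r. k (qs ! r) x)"

definition info_gain :: "('a \<Rightarrow> 'a \<Rightarrow> real) \<Rightarrow> real \<Rightarrow> 'a list \<Rightarrow> real" where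
  "info_gain k \<sigma> qs =
     1 / 2 * ln (Determinant.det (1\<^sub>m (length qs) + (1 / \<sigma>\<^sup>2) \<cdot>\<^sub>m kernel_mat k qs))"

definition max_info_gain :: "('a \<Rightarrow> 'a \<Rightarrow> real) \<Rightarrow> real \<Rightarrow> 'a set \<Rightarrow> nat \<Rightarrow> real" where
  "max_info_gain k \<sigma> X t = Max (info_gain k \<sigma> ` {qs. set qs \<subseteq> X \<and> length qs = t})"

text \<open>For \<open>\<sigma> > 0\<close> and \<open>k\<close> positive semidefinite on the query points, the matrix is invertible, so
  that \<open>the\<close> is harmless.\<close>

definition reg_inverse :: "('a \<Rightarrow> 'a \<Rightarrow> real) \<Rightarrow> real \<Rightarrow> 'a list \<Rightarrow> real mat" where
  "reg_inverse k \<sigma> qs = the (mat_inverse (kernel_mat k qs + \<sigma>\<^sup>2 \<cdot>\<^sub>m 1\<^sub>m (length qs)))"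

definition post_mean :: "('a \<Rightarrow> 'a \<Rightarrow> real) \<Rightarrow> real \<Rightarrow> 'a list \<Rightarrow> real list \<Rightarrow> 'a \<Rightarrow> real" where
  "post_mean k \<sigma> qs ys x =
     scalar_prod (kernel_vec k qs x) (reg_inverse k \<sigma> qs *\<^sub>v vec_of_list ys)"

definition post_sd :: "('a \<Rightarrow> 'a \<Rightarrow> real) \<Rightarrow> real \<Rightarrow> 'a list \<Rightarrow> 'a \<Rightarrow> real" where
  "post_sd k \<sigma> qs x =
     sqrt (k x x - scalar_prod (kernel_vec k qs x) (reg_inverse k \<sigma> qs *\<^sub>v kernel_vec k qs x))"


subsection \<open>Robust objective\<close>

text \<open>\<open>D\<close> is the given dissimilarity function; it need not be the metric of the space.\<close>

definition perturb :: "'a::ab_group_add set \<Rightarrow> ('a \<Rightarrow> 'a \<Rightarrow> real) \<Rightarrow> real \<Rightarrow> 'a \<Rightarrow> 'a set" where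
  "perturb X D \<xi> x = {x' - x | x'. x' \<in> X \<and> D x x' \<le> \<xi>}"

definition robust_min ::
  "'a::ab_group_add set \<Rightarrow> ('a \<Rightarrow> 'a \<Rightarrow> real) \<Rightarrow> real \<Rightarrow> ('a \<Rightarrow> real) \<Rightarrow> 'a \<Rightarrow> real" where
  "robust_min X D \<xi> g x = Min ((\<lambda>\<delta>. g (x + \<delta>)) ` perturb X D \<xi> x)"

definition robust_optimal ::
  "'a::ab_group_add set \<Rightarrow> ('a \<Rightarrow> 'a \<Rightarrow> real) \<Rightarrow> real \<Rightarrow> ('a \<Rightarrow> real) \<Rightarrow> 'a \<Rightarrow> bool" where
  "robust_optimal X D \<xi> f xopt \<longleftrightarrow>
     xopt \<in> X \<and> (\<forall>x\<in>X. robust_min X D \<xi> f x \<le> robust_min X D \<xi> f xopt)"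

definition robust_regret ::
  "'a::ab_group_add set \<Rightarrow> ('a \<Rightarrow> 'a \<Rightarrow> real) \<Rightarrow> real \<Rightarrow> ('a \<Rightarrow> real) \<Rightarrow> 'a \<Rightarrow> 'a \<Rightarrow> real" where
  "robust_regret X D \<xi> f xopt x = robust_min X D \<xi> f xopt - robust_min X D \<xi> f x"

definition cum_regret ::
  "'a::ab_group_add set \<Rightarrow> ('a \<Rightarrow> 'a \<Rightarrow> real) \<Rightarrow> real \<Rightarrow> ('a \<Rightarrow> real) \<Rightarrow> 'a \<Rightarrow> nat \<Rightarrow> (nat \<Rightarrow> 'a) \<Rightarrow> real"
  where
  "cum_regret X D \<xi> f xopt T x = (\<Sum>t=1..T. robust_regret X D \<xi> f xopt (x t))"


subsection \<open>Batches\<close>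

function batch_size :: "real \<Rightarrow> nat \<Rightarrow> nat \<Rightarrow> nat" where
  "batch_size a T i =
     min (nat \<lceil>real T powr (1 - a ^ i)\<rceil>) (T - (\<Sum>j\<in>{1..<i}. batch_size a T j))"
  by auto
termination
  by (relation "Wellfounded.measure (\<lambda>(a, T, i). i)") auto

declare batch_size.simps [simp del]

definition num_batches :: "real \<Rightarrow> nat \<Rightarrow> nat" where
  "num_batches a T = (LEAST B. (\<Sum>i=1..B. batch_size a T i) = T)"

text \<open>Number of time steps before batch \<open>i\<close>; the \<open>j\<close>-th step of batch \<open>i\<close> is time
  \<open>batch_start a T i + j\<close>, with \<open>i, j\<close> and time counted from 1.\<close>

definition batch_start :: "real \<Rightarrow> nat \<Rightarrow> nat \<Rightarrow> nat" where
  "batch_start a T i = (\<Sum>j\<in>{1..<i}. batch_size a T j)"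


subsection \<open>The robust-BPE algorithm\<close>

definition bpe_beta :: "real \<Rightarrow> nat \<Rightarrow> nat \<Rightarrow> real \<Rightarrow> real" where
  "bpe_beta \<Psi> n B \<delta> = (\<Psi> + sqrt (2 * ln (real n * real B / \<delta>)))\<^sup>2"

text \<open>\<open>robust_bpe X k D \<xi> \<Psi> \<sigma> a T \<delta> x u y\<close>: the points \<open>x t\<close>, perturbations \<open>u t\<close> and observations
  \<open>y t\<close> (\<open>1 \<le> t \<le> T\<close>) form a possible execution of the algorithm with confidence parameter
  \<open>\<delta>\<close>. \<open>S i\<close> is the set of points still active in batch \<open>i\<close>, and \<open>q i j\<close> lists the
  first \<open>j\<close> query points of batch \<open>i\<close>. Ties between maximisers may be broken in any way.\<close>

definition robust_bpe ::
  "'a::ab_group_add set \<Rightarrow> ('a \<Rightarrow> 'a \<Rightarrow> real) \<Rightarrow> ('a \<Rightarrow> 'a \<Rightarrow> real) \<Rightarrow> real \<Rightarrow> real \<Rightarrow> real \<Rightarrow> real \<Rightarrow> nat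
     \<Rightarrow> real \<Rightarrow> (nat \<Rightarrow> 'a) \<Rightarrow> (nat \<Rightarrow> 'a) \<Rightarrow> (nat \<Rightarrow> real) \<Rightarrow> bool" where
  "robust_bpe X k D \<xi> \<Psi> \<sigma> a T \<delta> x u y \<longleftrightarrow>
     (let B = num_batches a T;
          N = batch_size a T;
          time = (\<lambda>i j. batch_start a T i + j);
          q = (\<lambda>i j. map (\<lambda>j'. x (time i j') + u (time i j')) [1..<Suc j]);
          obs = (\<lambda>i. map (\<lambda>j'. y (time i j')) [1..<Suc (N i)]);
          mu = (\<lambda>i. post_mean k \<sigma> (q i (N i)) (obs i));
          sd = (\<lambda>i. post_sd k \<sigma> (q i (N i)));
          \<beta> = bpe_beta \<Psi> (card X) B \<delta>;
          ucb = (\<lambda>i v. mu i v + sqrt \<beta> * sd i v);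
          lcb = (\<lambda>i v. mu i v - sqrt \<beta> * sd i v)
      in \<exists>S :: nat \<Rightarrow> 'a set.
           S 1 = X \<and>
           (\<forall>i\<in>{1..B}.
              (\<forall>j\<in>{1..N i}.
                 x (time i j) \<in> S i \<and>
                 u (time i j) \<in> perturb X D \<xi> (x (time i j)) \<and>
                 (\<forall>v \<in> (\<Union>w\<in>S i. {w + \<eta> | \<eta>. \<eta> \<in> perturb X D \<xi> w}).
                    post_sd k \<sigma> (q i (j - 1)) v
                      \<le> post_sd k \<sigma> (q i (j - 1)) (x (time i j) + u (time i j)))) \<and>
              S (Suc i) = {w \<in> S i. Max (robust_min X D \<xi> (lcb i) ` S i)
                                      \<le> robust_min X D \<xi> (ucb i) w}))"

text \<open>The stochastic environment. \<open>F t\<close> collects the noise up to time \<open>t\<close> together with any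
  randomness used for tie-breaking. That \<open>z\<close> is adapted to \<open>F\<close> and \<open>z t\<close> is independent of
  \<open>F (t - 1)\<close> makes the noise terms mutually independent. The choices in batch \<open>i\<close> are measurable
  with respect to \<open>F\<close> at the end of batch \<open>i - 1\<close>: they cannot depend on observations not yet
  revealed, nor on future noise.\<close>

locale robust_bpe_run = prob_space M
  for M :: "'w measure"
    and X :: "(real ^ 'd) set"
    and k D :: "real ^ 'd \<Rightarrow> real ^ 'd \<Rightarrow> real"
    and \<xi> \<Psi> \<sigma> a :: real
    and T :: nat
    and \<delta> :: real
    and f :: "real ^ 'd \<Rightarrow> real"
    and F :: "nat \<Rightarrow> 'w measure"
    and z :: "nat \<Rightarrow> 'w \<Rightarrow> real"
    and x u :: "nat \<Rightarrow> 'w \<Rightarrow> real ^ 'd" +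
  assumes finite_X: "finite X"
    and nonempty_X: "X \<noteq> {}"
    and unit_cube: "X \<subseteq> cbox 0 1"
    and rkhs_f: "rkhs_norm_le X k f \<Psi>"
    and perturb_nonempty: "\<And>v. v \<in> X \<Longrightarrow> perturb X D \<xi> v \<noteq> {}"
    and sub_F: "\<And>t. subalgebra M (F t)"
    and mono_F: "\<And>s t. s \<le> t \<Longrightarrow> sets (F s) \<subseteq> sets (F t)"
    and noise_normal: "\<And>t. t \<in> {1..T} \<Longrightarrow> distributed M lborel (z t) (normal_density 0 \<sigma>)"
    and noise_adapted: "\<And>t. t \<in> {1..T} \<Longrightarrow> z t \<in> borel_measurable (F t)"
    and noise_indep: "\<And>t. t \<in> {1..T} \<Longrightarrow>
          indep_set (sets (F (t - 1))) {z t -` A \<inter> space M | A. A \<in> sets borel}"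
    and choice_measurable: "\<And>i j. i \<in> {1..num_batches a T} \<Longrightarrow> j \<in> {1..batch_size a T i} \<Longrightarrow>
          x (batch_start a T i + j) \<in> borel_measurable (F (batch_start a T i)) \<and>
          u (batch_start a T i + j) \<in> borel_measurable (F (batch_start a T i))"
    and algorithm: "\<And>\<omega>. \<omega> \<in> space M \<Longrightarrow>
          robust_bpe X k D \<xi> \<Psi> \<sigma> a T \<delta> (\<lambda>t. x t \<omega>) (\<lambda>t. u t \<omega>)
            (\<lambda>t. f (x t \<omega> + u t \<omega>) + z t \<omega>)"

end

theory Submission
  imports Defs
begin

text \<open>On the event that all posterior means are within \<open>\<surd>\<beta>\<close> posterior standard deviations of \<open>f\<close>,
  the robust optimum is never eliminated, and a point surviving batch \<open>i\<close> has regret at most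
  \<open>4 \<surd>\<beta> W\<^sub>i\<close>, where \<open>W\<^sub>i = O(sqrt (\<gamma>(N\<^sub>i) / N\<^sub>i))\<close> bounds the posterior standard deviation after the
  batch: the greedy choices make its square at most the average variance at the query points, and
  these add up to the information gain. The event has probability at least \<open>1 - \<delta>\<close>: the deviation
  is an RKHS interpolation error plus a linear combination of noise terms that, given the past, is
  Gaussian with fixed coefficients.

  With \<open>\<theta> = 1/2\<close> in the first part and \<open>\<theta> = \<nu> / (2 \<nu> + d)\<close> in the second, the bound on \<open>W\<^sub>i\<close> is
  proportional to \<open>N\<^sub>i powr - \<theta>\<close>, and batch \<open>i + 1\<close> contributes \<open>T powr (1 - \<theta> - (a - \<theta>) a ^ i)\<close>.
  These terms decay doubly exponentially away from the last batches, so their sum is of the order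
  \<open>T powr (1 - \<theta>)\<close> without a factor for the number of batches. That number is
  \<open>O(ln (ln T))\<close> and only enters through \<open>\<beta>\<close>.\<close>


subsection \<open>Gaussian process posterior and information gain\<close>

text \<open>Two facts explain the form of \<open>bpe_beta\<close>. At its optimal weights the
  posterior variance is a squared feature distance plus \<open>\<sigma>\<^sup>2\<close> times the
  sum of squared weights. Dropping one summand at a time, the same standard deviation controls the
  interpolation error, with factor \<open>\<Psi>\<close>, and the spread of the noise part, with
  factor \<open>sqrt (2 * ln (card X * B / \<delta>))\<close>. The obstacle is that the weights
  depend on query points that depend on earlier noise. A whole batch of query points is determined
  by the past at its start and takes finitely many values, so the tail bound is applied on each
  event on which the list is constant. These events are disjoint, so their bounds are averaged, and
  the union bound runs over batches and points only, not over lists. The regret of batch 1 carries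
  no information gain factor. It is absorbed because a single observation already yields an amount
  of information bounded below by a constant. The last batch may be cut short by the horizon; as
  each batch is charged to the width after its predecessor, only widths of uncut batches
  enter.\<close>

locale gp_kernel =
  fixes X :: "'a set" and k :: "'a \<Rightarrow> 'a \<Rightarrow> real" and \<sigma> :: real
  assumes kernel_sym: "\<And>x y. x \<in> X \<Longrightarrow> y \<in> X \<Longrightarrow> k x y = k y x"
    and kernel_psd: "\<And>qs w. set qs \<subseteq> X \<Longrightarrow>
      0 \<le> (\<Sum>r<length qs. \<Sum>s<length qs. w r * w s * k (qs ! r) (qs ! s))"
    and noise_pos: "\<sigma> > 0"
begin

text \<open>The bilinear form of the regularised kernel matrix,
  \<open>v\<^sup>T (K + \<sigma>\<^sup>2 I) w\<close>, written with index sums so that weights can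
  be plain functions on indices.\<close>

definition reg_form :: "'a list \<Rightarrow> (nat \<Rightarrow> real) \<Rightarrow> (nat \<Rightarrow> real) \<Rightarrow> real" where
  "reg_form qs v w = (\<Sum>r<length qs. \<Sum>s<length qs. v r * w s * k (qs ! r) (qs ! s))
     + \<sigma>\<^sup>2 * (\<Sum>r<length qs. v r * w r)"

definition reg_mat :: "'a list \<Rightarrow> real mat" where
  "reg_mat qs = kernel_mat k qs + \<sigma>\<^sup>2 \<cdot>\<^sub>m 1\<^sub>m (length qs)"

text \<open>The kernel ridge regression coefficients
  \<open>(K + \<sigma>\<^sup>2 I)\<^sup>-\<^sup>1 k(v)\<close>; only the values at indices below
  \<open>length qs\<close> are meaningful.\<close>

definition gp_weights :: "'a list \<Rightarrow> 'a \<Rightarrow> nat \<Rightarrow> real" where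
  "gp_weights qs v = vec_index (reg_inverse k \<sigma> qs *\<^sub>v kernel_vec k qs v)"

definition post_var :: "'a list \<Rightarrow> 'a \<Rightarrow> real" where
  "post_var qs v = k v v - (\<Sum>r<length qs. k (qs ! r) v * gp_weights qs v r)"

lemma reg_mat_carrier [simp]: "reg_mat qs \<in> carrier_mat (length qs) (length qs)"
  by (auto simp: reg_mat_def kernel_mat_def)

lemma reg_mat_mult_index:
  assumes "r < length qs" "w \<in> carrier_vec (length qs)"
  shows "vec_index (reg_mat qs *\<^sub>v w) r
    = (\<Sum>s<length qs. k (qs ! r) (qs ! s) * vec_index w s) + \<sigma>\<^sup>2 * vec_index w r"
proof -
  have "vec_index (reg_mat qs *\<^sub>v w) r
      = (\<Sum>s<length qs. (k (qs ! r) (qs ! s) + \<sigma>\<^sup>2 * (if r = s then 1 else 0)) * vec_index w s)"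
    using assms
    by (auto simp: reg_mat_def kernel_mat_def scalar_prod_def atLeast0LessThan intro!: sum.cong)
  also have "\<dots> = (\<Sum>s<length qs. k (qs ! r) (qs ! s) * vec_index w s)
      + (\<Sum>s<length qs. if r = s then \<sigma>\<^sup>2 * vec_index w s else 0)"
    unfolding sum.distrib[symmetric] by (rule sum.cong) (auto simp: algebra_simps)
  finally show ?thesis using assms by simp
qed

lemma reg_form_reg_mat:
  assumes "w \<in> carrier_vec (length qs)"
  shows "reg_form qs v (vec_index w)
    = (\<Sum>r<length qs. v r * vec_index (reg_mat qs *\<^sub>v w) r)"
  using assms
  by (auto simp: reg_form_def reg_mat_mult_index sum_distrib_left sum.distrib[symmetric]
      algebra_simps intro!: sum.cong)

lemma reg_form_ge:
  assumes "set qs \<subseteq> X"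
  shows "\<sigma>\<^sup>2 * (\<Sum>r<length qs. (w r)\<^sup>2) \<le> reg_form qs w w"
  using kernel_psd[OF assms, of w] by (simp add: reg_form_def power2_eq_square)

lemma reg_form_nonneg: "set qs \<subseteq> X \<Longrightarrow> 0 \<le> reg_form qs w w"
  using reg_form_ge[of qs w] by (smt (verit) mult_nonneg_nonneg sum_nonneg zero_le_power2)

lemma reg_form_sym:
  assumes "set qs \<subseteq> X"
  shows "reg_form qs v w = reg_form qs w v"
proof -
  have "(\<Sum>r<length qs. \<Sum>s<length qs. v r * w s * k (qs ! r) (qs ! s))
      = (\<Sum>s<length qs. \<Sum>r<length qs. v r * w s * k (qs ! r) (qs ! s))"
    by (rule sum.swap)
  also have "\<dots> = (\<Sum>s<length qs. \<Sum>r<length qs. w s * v r * k (qs ! s) (qs ! r))"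
  proof (intro sum.cong refl)
    fix s r assume "s \<in> {..<length qs}" "r \<in> {..<length qs}"
    then have "qs ! s \<in> X" "qs ! r \<in> X" using assms by auto
    then show "v r * w s * k (qs ! r) (qs ! s) = w s * v r * k (qs ! s) (qs ! r)"
      using kernel_sym by (simp add: mult.commute)
  qed
  finally show ?thesis by (simp add: reg_form_def mult.commute)
qed

lemma reg_form_diff_left:
  "reg_form qs (\<lambda>r. v r - w r) u = reg_form qs v u - reg_form qs w u"
  by (simp add: reg_form_def left_diff_distrib right_diff_distrib sum_subtractf)

lemma reg_form_diff_right:
  "reg_form qs u (\<lambda>r. v r - w r) = reg_form qs u v - reg_form qs u w"
  by (simp add: reg_form_def left_diff_distrib right_diff_distrib sum_subtractf)

text \<open>A null vector of the matrix would make the form vanish, but the form is at least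
  \<open>\<sigma>\<^sup>2\<close> times the squared length. Hence the determinant is nonzero, and
  \<open>the\<close> in \<open>reg_inverse\<close> is applied to a genuine inverse.\<close>

lemma reg_mat_inverse:
  assumes "set qs \<subseteq> X"
  shows "reg_mat qs * reg_inverse k \<sigma> qs = 1\<^sub>m (length qs)"
    and "reg_inverse k \<sigma> qs * reg_mat qs = 1\<^sub>m (length qs)"
    and "reg_inverse k \<sigma> qs \<in> carrier_mat (length qs) (length qs)"
proof -
  let ?n = "length qs"
  have "Determinant.det (reg_mat qs) \<noteq> 0"
  proof
    assume "Determinant.det (reg_mat qs) = 0"
    then obtain w where w: "w \<in> carrier_vec ?n" "w \<noteq> 0\<^sub>v ?n" "reg_mat qs *\<^sub>v w = 0\<^sub>v ?n"
      using det_0_iff_vec_prod_zero_field[OF reg_mat_carrier[of qs]] by auto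
    have "reg_form qs (vec_index w) (vec_index w) = 0"
      using w by (simp add: reg_form_reg_mat)
    then have "\<sigma>\<^sup>2 * (\<Sum>r<?n. (vec_index w r)\<^sup>2) \<le> 0"
      using reg_form_ge[OF assms, of "vec_index w"] by simp
    then have "(\<Sum>r<?n. (vec_index w r)\<^sup>2) \<le> 0"
      using noise_pos by (simp add: mult_le_0_iff not_le)
    then have "(\<Sum>r<?n. (vec_index w r)\<^sup>2) = 0"
      by (intro antisym sum_nonneg) auto
    then have "\<forall>r<?n. vec_index w r = 0"
      by (subst (asm) sum_nonneg_eq_0_iff) auto
    then have "w = 0\<^sub>v ?n" using w(1) by (intro eq_vecI) auto
    with w(2) show False by simp
  qed
  from det_non_zero_imp_unit[OF reg_mat_carrier this]
  have "reg_mat qs \<in> Units (ring_mat TYPE(real) ?n ())" .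
  then have "mat_inverse (reg_mat qs) \<noteq> None"
    using mat_inverse(1)[OF reg_mat_carrier[of qs], of "()"] by blast
  then obtain R where R: "mat_inverse (reg_mat qs) = Some R" by blast
  then have "reg_inverse k \<sigma> qs = R" by (simp add: reg_inverse_def reg_mat_def)
  with mat_inverse(2)[OF reg_mat_carrier R]
  show "reg_mat qs * reg_inverse k \<sigma> qs = 1\<^sub>m ?n" "reg_inverse k \<sigma> qs * reg_mat qs = 1\<^sub>m ?n"
    "reg_inverse k \<sigma> qs \<in> carrier_mat ?n ?n" by auto
qed

lemma kernel_vec_carrier [simp]: "kernel_vec k qs v \<in> carrier_vec (length qs)"
  by (simp add: kernel_vec_def)

lemma reg_mat_solve:
  assumes "set qs \<subseteq> X" "b \<in> carrier_vec (length qs)"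
  shows "reg_mat qs *\<^sub>v (reg_inverse k \<sigma> qs *\<^sub>v b) = b"
    and "reg_inverse k \<sigma> qs *\<^sub>v b \<in> carrier_vec (length qs)"
  using reg_mat_inverse[OF assms(1)] assms(2)
    assoc_mult_mat_vec[OF reg_mat_carrier reg_mat_inverse(3)[OF assms(1)] assms(2)]
  by auto

text \<open>The weights solve the regularised linear system. This identity is how the inverse enters
  the variance computations below.\<close>

lemma reg_form_gp_weights:
  assumes "set qs \<subseteq> X"
  shows "reg_form qs w (gp_weights qs v) = (\<Sum>r<length qs. w r * k (qs ! r) v)"
  using reg_mat_solve[OF assms kernel_vec_carrier[of qs v]]
  by (simp add: gp_weights_def reg_form_reg_mat kernel_vec_def)

lemma post_sd_eq:
  assumes "set qs \<subseteq> X"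
  shows "post_sd k \<sigma> qs v = sqrt (post_var qs v)"
  using reg_mat_inverse(3)[OF assms]
  by (auto simp: post_sd_def post_var_def scalar_prod_def gp_weights_def kernel_vec_def
      atLeast0LessThan intro!: sum.cong)

text \<open>Symmetry of the form moves the inverse from the observations to the kernel vector. The
  mean thus becomes linear in the observations, with coefficients that depend on the query points
  alone.\<close>

lemma post_mean_eq:
  assumes "set qs \<subseteq> X" "length ys = length qs"
  shows "post_mean k \<sigma> qs ys v = (\<Sum>r<length qs. gp_weights qs v r * ys ! r)"
proof -
  let ?b = "vec_of_list ys"
  define w where "w = reg_inverse k \<sigma> qs *\<^sub>v ?b"
  have b: "?b \<in> carrier_vec (length qs)" using assms(2) by (simp add: carrier_vecI)
  note sol = reg_mat_solve[OF assms(1) b, folded w_def]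
  have "post_mean k \<sigma> qs ys v = (\<Sum>r<length qs. vec_index w r * k (qs ! r) v)"
    using carrier_vecD[OF sol(2)]
    by (simp add: post_mean_def w_def[symmetric] scalar_prod_def kernel_vec_def atLeast0LessThan
        mult.commute)
  also have "\<dots> = reg_form qs (gp_weights qs v) (vec_index w)"
    by (simp add: reg_form_gp_weights[OF assms(1)] reg_form_sym[OF assms(1), of "gp_weights qs v"])
  also have "\<dots> = (\<Sum>r<length qs. gp_weights qs v r * vec_index ?b r)"
    using sol by (simp add: reg_form_reg_mat)
  finally show ?thesis using assms(2) by (simp add: vec_of_list_index)
qed

text \<open>The posterior variance is the minimum over all weights of the regularised squared distance
  of the feature of \<open>v\<close> to the weighted sum of the features of the query points.\<close>

definition feature_dist2 :: "'a list \<Rightarrow> (nat \<Rightarrow> real) \<Rightarrow> 'a \<Rightarrow> real" where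
  "feature_dist2 qs w v = k v v - 2 * (\<Sum>r<length qs. w r * k (qs ! r) v)
     + (\<Sum>r<length qs. \<Sum>s<length qs. w r * w s * k (qs ! r) (qs ! s))"

text \<open>Prepending the weight \<open>- 1\<close> for \<open>v\<close>, which is what
  \<open>case_nat (- 1) w\<close> does, exhibits the distance as a kernel quadratic form on
  \<open>v # qs\<close>, so positive semidefiniteness applies to it.\<close>

lemma feature_dist2_eq:
  assumes "set qs \<subseteq> X" "v \<in> X"
  shows "feature_dist2 qs w v = (\<Sum>r<length (v # qs). \<Sum>s<length (v # qs).
    case_nat (- 1) w r * case_nat (- 1) w s * k ((v # qs) ! r) ((v # qs) ! s))"
proof -
  have "(\<Sum>r<length (v # qs). \<Sum>s<length (v # qs).
      case_nat (- 1) w r * case_nat (- 1) w s * k ((v # qs) ! r) ((v # qs) ! s))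
    = k v v - (\<Sum>s<length qs. w s * k v (qs ! s)) - (\<Sum>r<length qs. w r * k (qs ! r) v)
      + (\<Sum>r<length qs. \<Sum>s<length qs. w r * w s * k (qs ! r) (qs ! s))"
    by (simp add: sum.lessThan_Suc_shift sum.distrib sum_negf sum_subtractf del: sum.lessThan_Suc)
  also have "(\<Sum>s<length qs. w s * k v (qs ! s)) = (\<Sum>r<length qs. w r * k (qs ! r) v)"
    using assms by (intro sum.cong) (auto simp: kernel_sym subset_iff)
  finally show ?thesis by (simp add: feature_dist2_def)
qed

lemma feature_dist2_nonneg:
  assumes "set qs \<subseteq> X" "v \<in> X"
  shows "0 \<le> feature_dist2 qs w v"
  unfolding feature_dist2_eq[OF assms] using assms by (intro kernel_psd) auto

text \<open>At the optimal weights the sum \<open>\<Sum>r. w r * k (qs ! r) v\<close> equals the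
  form \<open>reg_form qs w w\<close>, so one of its two copies cancels. The two summands are later
  used separately, for bias and for noise.\<close>

lemma post_var_gp_weights:
  assumes "set qs \<subseteq> X"
  shows "post_var qs v = feature_dist2 qs (gp_weights qs v) v
    + \<sigma>\<^sup>2 * (\<Sum>r<length qs. (gp_weights qs v r)\<^sup>2)"
  using reg_form_gp_weights[OF assms, of "gp_weights qs v" v]
  by (simp add: post_var_def feature_dist2_def reg_form_def power2_eq_square mult.commute)

text \<open>Completing the square: the excess over the optimum is the regularised form at the
  difference from the optimal weights.\<close>

lemma post_var_le:
  assumes "set qs \<subseteq> X"
  shows "post_var qs v \<le> feature_dist2 qs w v + \<sigma>\<^sup>2 * (\<Sum>r<length qs. (w r)\<^sup>2)"
proof -
  let ?u = "gp_weights qs v"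
  have "0 \<le> reg_form qs (\<lambda>r. w r - ?u r) (\<lambda>r. w r - ?u r)"
    by (rule reg_form_nonneg[OF assms])
  also have "\<dots> = reg_form qs w w - 2 * reg_form qs w ?u + reg_form qs ?u ?u"
    by (simp add: reg_form_diff_left reg_form_diff_right reg_form_sym[OF assms, of ?u w])
  finally show ?thesis
    by (simp add: reg_form_gp_weights[OF assms] post_var_def feature_dist2_def reg_form_def[of qs w w]
        power2_eq_square mult.commute)
qed

lemma post_var_nonneg: "set qs \<subseteq> X \<Longrightarrow> v \<in> X \<Longrightarrow> 0 \<le> post_var qs v"
  using feature_dist2_nonneg[of qs v "gp_weights qs v"]
  by (simp add: post_var_gp_weights sum_nonneg)

lemma post_sd_nonneg: "set qs \<subseteq> X \<Longrightarrow> v \<in> X \<Longrightarrow> 0 \<le> post_sd k \<sigma> qs v"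
  by (simp add: post_sd_eq post_var_nonneg)

lemma post_sd_sq: "set qs \<subseteq> X \<Longrightarrow> v \<in> X \<Longrightarrow> (post_sd k \<sigma> qs v)\<^sup>2 = post_var qs v"
  by (simp add: post_sd_eq post_var_nonneg)

text \<open>The optimal weights of the shorter list, padded with zeros, compete in the minimisation
  for the longer list.\<close>

lemma post_var_append:
  assumes "set (qs @ rs) \<subseteq> X"
  shows "post_var (qs @ rs) v \<le> post_var qs v"
proof -
  let ?n = "length qs" and ?m = "length (qs @ rs)"
  let ?w = "\<lambda>r. if r < ?n then gp_weights qs v r else 0"
  have ext: "(\<Sum>r<?m. if r < ?n then h r else 0) = (\<Sum>r<?n. h r)" for h :: "nat \<Rightarrow> real"
    by (rule sum.mono_neutral_cong_right) auto
  have 1: "(\<Sum>r<?m. ?w r * k ((qs @ rs) ! r) v) = (\<Sum>r<?n. gp_weights qs v r * k (qs ! r) v)"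
    by (subst ext[symmetric]) (auto simp: nth_append intro!: sum.cong)
  have 2: "(\<Sum>r<?m. (?w r)\<^sup>2) = (\<Sum>r<?n. (gp_weights qs v r)\<^sup>2)"
    by (subst ext[symmetric]) (auto intro!: sum.cong)
  have 3: "(\<Sum>r<?m. \<Sum>s<?m. ?w r * ?w s * k ((qs @ rs) ! r) ((qs @ rs) ! s))
    = (\<Sum>r<?n. \<Sum>s<?n. gp_weights qs v r * gp_weights qs v s * k (qs ! r) (qs ! s))"
  proof -
    have "(\<Sum>r<?m. \<Sum>s<?m. ?w r * ?w s * k ((qs @ rs) ! r) ((qs @ rs) ! s))
      = (\<Sum>r<?m. if r < ?n then (\<Sum>s<?m. if s < ?n then
          gp_weights qs v r * gp_weights qs v s * k (qs ! r) (qs ! s) else 0) else 0)"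
      by (auto simp: nth_append intro!: sum.cong sum.neutral)
    then show ?thesis by (simp only: ext)
  qed
  have "post_var (qs @ rs) v \<le> feature_dist2 (qs @ rs) ?w v + \<sigma>\<^sup>2 * (\<Sum>r<?m. (?w r)\<^sup>2)"
    by (rule post_var_le[OF assms])
  also have "\<dots> = feature_dist2 qs (gp_weights qs v) v + \<sigma>\<^sup>2 * (\<Sum>r<?n. (gp_weights qs v r)\<^sup>2)"
    by (simp only: feature_dist2_def 1 2 3)
  also have "\<dots> = post_var qs v"
    using assms by (simp add: post_var_gp_weights)
  finally show ?thesis .
qed

lemma post_var_le_diag: "set qs \<subseteq> X \<Longrightarrow> post_var qs v \<le> k v v"
  using post_var_append[of "[]" qs v] by (simp add: post_var_def)

text \<open>The determinant of the bordered matrix is computed by column elimination: the weights solve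
  the linear system given by the top left block.\<close>

lemma det_info_snoc:
  assumes "set (qs @ [v]) \<subseteq> X"
  defines "I \<equiv> \<lambda>qs. 1\<^sub>m (length qs) + (1 / \<sigma>\<^sup>2) \<cdot>\<^sub>m kernel_mat k qs"
  shows "Determinant.det (I (qs @ [v])) = Determinant.det (I qs) * (1 + post_var qs v / \<sigma>\<^sup>2)"
proof -
  let ?n = "length qs"
  let ?w = "mat ?n 1 (\<lambda>(r, _). - gp_weights qs v r)"
  let ?c = "mat 1 ?n (\<lambda>(_, s). k v (qs ! s) / \<sigma>\<^sup>2)"
  let ?E = "four_block_mat (1\<^sub>m ?n) ?w (0\<^sub>m 1 ?n) (1\<^sub>m 1)"
  let ?R = "four_block_mat (I qs) (0\<^sub>m ?n 1) ?c (mat 1 1 (\<lambda>_. 1 + post_var qs v / \<sigma>\<^sup>2))"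
  have qs: "set qs \<subseteq> X" and v: "v \<in> X" using assms by auto
  have I: "I rs \<in> carrier_mat (length rs) (length rs)" for rs :: "'a list"
    by (intro carrier_matI) (simp_all add: I_def kernel_mat_def)
  have Isplit: "I (qs @ [v]) = four_block_mat (I qs) (mat ?n 1 (\<lambda>(r, _). k (qs ! r) v / \<sigma>\<^sup>2))
      ?c (mat 1 1 (\<lambda>_. 1 + k v v / \<sigma>\<^sup>2))"
    by (rule eq_matI) (auto simp: I_def kernel_mat_def nth_append less_Suc_eq)
  have row: "(\<Sum>s<?n. k (qs ! r) (qs ! s) * gp_weights qs v s) + \<sigma>\<^sup>2 * gp_weights qs v r
      = k (qs ! r) v" if "r < ?n" for r
    using reg_mat_solve[OF qs kernel_vec_carrier[of qs v]] that
      reg_mat_mult_index[OF that, of "reg_inverse k \<sigma> qs *\<^sub>v kernel_vec k qs v"]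
    by (simp add: gp_weights_def kernel_vec_def)
  have "I (qs @ [v]) * ?E = ?R"
  proof -
    have "I (qs @ [v]) * ?E = four_block_mat
        (I qs * 1\<^sub>m ?n + mat ?n 1 (\<lambda>(r, _). k (qs ! r) v / \<sigma>\<^sup>2) * 0\<^sub>m 1 ?n)
        (I qs * ?w + mat ?n 1 (\<lambda>(r, _). k (qs ! r) v / \<sigma>\<^sup>2) * 1\<^sub>m 1)
        (?c * 1\<^sub>m ?n + mat 1 1 (\<lambda>_. 1 + k v v / \<sigma>\<^sup>2) * 0\<^sub>m 1 ?n)
        (?c * ?w + mat 1 1 (\<lambda>_. 1 + k v v / \<sigma>\<^sup>2) * 1\<^sub>m 1)"
      unfolding Isplit by (rule mult_four_block_mat[OF I[of qs] mat_carrier mat_carrier mat_carrier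
          one_carrier_mat mat_carrier zero_carrier_mat one_carrier_mat])
    also have "I qs * 1\<^sub>m ?n + mat ?n 1 (\<lambda>(r, _). k (qs ! r) v / \<sigma>\<^sup>2) * 0\<^sub>m 1 ?n = I qs"
      using I[of qs] by (simp add: right_add_zero_mat[of _ ?n ?n])
    also have "?c * 1\<^sub>m ?n + mat 1 1 (\<lambda>_. 1 + k v v / \<sigma>\<^sup>2) * 0\<^sub>m 1 ?n = ?c"
      by (simp add: right_add_zero_mat[of _ 1 ?n])
    also have "I qs * ?w + mat ?n 1 (\<lambda>(r, _). k (qs ! r) v / \<sigma>\<^sup>2) * 1\<^sub>m 1 = 0\<^sub>m ?n 1"
    proof (rule eq_matI)
      fix r c assume "r < dim_row (0\<^sub>m ?n 1 :: real mat)" "c < dim_col (0\<^sub>m ?n 1 :: real mat)"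
      then have r: "r < ?n" and c: "c = 0" by auto
      have "(\<Sum>s<?n. ((if s = r then 1 else 0) + k (qs ! r) (qs ! s) / \<sigma>\<^sup>2) * (- gp_weights qs v s))
        = - (\<Sum>s<?n. if s = r then gp_weights qs v s else 0)
          - (\<Sum>s<?n. k (qs ! r) (qs ! s) * gp_weights qs v s) / \<sigma>\<^sup>2"
        unfolding sum_negf[symmetric] sum_divide_distrib sum_subtractf[symmetric]
        by (intro sum.cong) (auto simp: algebra_simps)
      also have "\<dots> = - k (qs ! r) v / \<sigma>\<^sup>2"
        using r row[OF r, symmetric] noise_pos by (simp add: field_simps)
      finally show "(I qs * ?w + mat ?n 1 (\<lambda>(r, _). k (qs ! r) v / \<sigma>\<^sup>2) * 1\<^sub>m 1) $$ (r, c)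
          = 0\<^sub>m ?n 1 $$ (r, c)"
        using r c by (simp add: I_def kernel_mat_def scalar_prod_def atLeast0LessThan)
    qed (use I in auto)
    also have "?c * ?w + mat 1 1 (\<lambda>_. 1 + k v v / \<sigma>\<^sup>2) * 1\<^sub>m 1
        = mat 1 1 (\<lambda>_. 1 + post_var qs v / \<sigma>\<^sup>2)"
    proof -
      have "(\<Sum>s<?n. k v (qs ! s) * gp_weights qs v s) = (\<Sum>s<?n. k (qs ! s) v * gp_weights qs v s)"
        using qs v by (intro sum.cong) (auto simp: kernel_sym subset_iff)
      then show ?thesis
        by (intro eq_matI) (auto simp: post_var_def scalar_prod_def atLeast0LessThan sum_negf
            sum_divide_distrib[symmetric] diff_divide_distrib)
    qed
    finally show ?thesis .
  qed
  moreover have "Determinant.det (I (qs @ [v]) * ?E)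
      = Determinant.det (I (qs @ [v])) * Determinant.det ?E"
    by (rule Determinant.det_mult[of _ "Suc ?n"]) (use I[of "qs @ [v]"] in auto)
  moreover have "Determinant.det ?E = 1"
    by (subst det_four_block_mat_lower_left_zero[where n = ?n and m = 1]) auto
  moreover have "Determinant.det ?R = Determinant.det (I qs) * (1 + post_var qs v / \<sigma>\<^sup>2)"
    by (subst det_four_block_mat_upper_right_zero[where n = ?n and m = 1])
      (use I in \<open>auto simp: det_single\<close>)
  ultimately show ?thesis by simp
qed

lemma det_info_pos:
  assumes "set qs \<subseteq> X"
  shows "Determinant.det (1\<^sub>m (length qs) + (1 / \<sigma>\<^sup>2) \<cdot>\<^sub>m kernel_mat k qs) > 0"
  using assms
proof (induction qs rule: rev_induct)
  case (snoc v qs)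
  have "1 + post_var qs v / \<sigma>\<^sup>2 > 0"
    using post_var_nonneg[of qs v] snoc.prems by (simp add: add_pos_nonneg)
  with snoc det_info_snoc[of qs v] show ?case by simp
qed (simp add: kernel_mat_def)

text \<open>The chain rule for mutual information: a new point adds the information of one Gaussian
  observation whose signal variance is the current posterior variance.\<close>

lemma info_gain_snoc:
  assumes "set (qs @ [v]) \<subseteq> X"
  shows "info_gain k \<sigma> (qs @ [v]) = info_gain k \<sigma> qs + 1 / 2 * ln (1 + post_var qs v / \<sigma>\<^sup>2)"
proof -
  have "1 + post_var qs v / \<sigma>\<^sup>2 > 0"
    using post_var_nonneg[of qs v] assms by (simp add: add_pos_nonneg)
  then show ?thesis
    unfolding info_gain_def det_info_snoc[OF assms]
    using det_info_pos[of qs] assms by (simp add: ln_mult)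
qed

lemma info_gain_snoc_ge:
  assumes "set (qs @ [v]) \<subseteq> X"
  shows "info_gain k \<sigma> qs \<le> info_gain k \<sigma> (qs @ [v])"
  using post_var_nonneg[of qs v] assms by (simp add: info_gain_snoc)

lemma info_gain_append_ge:
  assumes "set (qs @ rs) \<subseteq> X"
  shows "info_gain k \<sigma> qs \<le> info_gain k \<sigma> (qs @ rs)"
  using assms
proof (induction rs rule: rev_induct)
  case (snoc r rs)
  then show ?case using info_gain_snoc_ge[of "qs @ rs" r] by simp
qed simp

text \<open>By the chain rule it suffices to compare one variance \<open>s\<close> in
  \<open>[0, 1]\<close> with \<open>ln (1 + y)\<close>, where
  \<open>y = s / \<sigma>\<^sup>2\<close>. From \<open>ln t \<le> t - 1\<close> at
  \<open>t = 1 / (1 + y)\<close> follows \<open>y \<le> (1 + y) * ln (1 + y)\<close>, and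
  \<open>1 + y \<le> 1 + 1 / \<sigma>\<^sup>2\<close> gives the factor
  \<open>\<sigma>\<^sup>2 + 1\<close>. The factor 2 undoes the \<open>1 / 2\<close> in
  \<open>info_gain\<close>.\<close>

lemma sum_post_var_le_info_gain:
  assumes "set qs \<subseteq> X" and diag: "\<And>v. v \<in> X \<Longrightarrow> k v v = 1"
  shows "(\<Sum>j<length qs. post_var (take j qs) (qs ! j)) \<le> 2 * (\<sigma>\<^sup>2 + 1) * info_gain k \<sigma> qs"
  using assms(1)
proof (induction qs rule: rev_induct)
  case Nil
  show ?case by (simp add: info_gain_def kernel_mat_def)
next
  case (snoc v qs)
  let ?s = "post_var qs v"
  have s: "0 \<le> ?s" "?s \<le> 1"
    using post_var_nonneg[of qs v] post_var_le_diag[of qs v] snoc.prems diag[of v] by auto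
  define y where "y = ?s / \<sigma>\<^sup>2"
  have y: "0 \<le> y" "y \<le> 1 / \<sigma>\<^sup>2" using s noise_pos by (auto simp: y_def divide_right_mono)
  have "ln (1 / (1 + y)) \<le> 1 / (1 + y) - 1"
    using y by (intro ln_le_minus_one) auto
  then have "y / (1 + y) \<le> ln (1 + y)" using y by (simp add: ln_div field_simps)
  then have "y \<le> (1 + y) * ln (1 + y)" using y by (simp add: field_simps)
  also have "\<dots> \<le> (1 + 1 / \<sigma>\<^sup>2) * ln (1 + y)" using y by (intro mult_right_mono) auto
  finally have "\<sigma>\<^sup>2 * y \<le> \<sigma>\<^sup>2 * ((1 + 1 / \<sigma>\<^sup>2) * ln (1 + y))"
    by (intro mult_left_mono) auto
  also have "\<dots> = (\<sigma>\<^sup>2 * (1 + 1 / \<sigma>\<^sup>2)) * ln (1 + y)" by simp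
  also have "\<sigma>\<^sup>2 * (1 + 1 / \<sigma>\<^sup>2) = \<sigma>\<^sup>2 + 1" using noise_pos by (simp add: distrib_left)
  also have "\<sigma>\<^sup>2 * y = ?s" using noise_pos by (simp add: y_def)
  finally have "?s \<le> (\<sigma>\<^sup>2 + 1) * ln (1 + y)" .
  moreover have "(\<Sum>j<length qs. post_var (take j (qs @ [v])) ((qs @ [v]) ! j))
      = (\<Sum>j<length qs. post_var (take j qs) (qs ! j))"
    by (intro sum.cong) (auto simp: nth_append)
  ultimately have "(\<Sum>j<length (qs @ [v]). post_var (take j (qs @ [v])) ((qs @ [v]) ! j))
      \<le> 2 * (\<sigma>\<^sup>2 + 1) * info_gain k \<sigma> qs + (\<sigma>\<^sup>2 + 1) * ln (1 + y)"
    using snoc by simp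
  also have "\<dots> = 2 * (\<sigma>\<^sup>2 + 1) * (info_gain k \<sigma> qs + 1 / 2 * ln (1 + y))"
    by (simp add: distrib_left)
  also have "\<dots> = 2 * (\<sigma>\<^sup>2 + 1) * info_gain k \<sigma> (qs @ [v])"
    using snoc.prems by (simp only: info_gain_snoc y_def)
  finally show ?case .
qed

end

section \<open>Maximum information gain: monotonicity in the number of points and a constant lower
  bound\<close>

lemma max_info_gain_ge:
  assumes "finite X" "set qs \<subseteq> X"
  shows "info_gain k \<sigma> qs \<le> max_info_gain k \<sigma> X (length qs)"
  unfolding max_info_gain_def
  using assms finite_lists_length_eq[OF assms(1), of "length qs"] by (intro Max_ge) auto

lemma max_info_gain_attained:
  assumes "finite X" "X \<noteq> {}"
  obtains qs where "set qs \<subseteq> X" "length qs = t" "max_info_gain k \<sigma> X t = info_gain k \<sigma> qs"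
proof -
  obtain v where v: "v \<in> X" using assms by auto
  have "replicate t v \<in> {qs. set qs \<subseteq> X \<and> length qs = t}" using v by auto
  then have "max_info_gain k \<sigma> X t \<in> info_gain k \<sigma> ` {qs. set qs \<subseteq> X \<and> length qs = t}"
    unfolding max_info_gain_def
    using finite_lists_length_eq[OF assms(1), of t] by (intro Max_in) auto
  then show ?thesis using that by auto
qed

context gp_kernel
begin

text \<open>A maximising list of the smaller length is padded with copies of an arbitrary point,
  which cannot lose information.\<close>

lemma max_info_gain_mono:
  assumes "finite X" "X \<noteq> {}" "s \<le> t"
  shows "max_info_gain k \<sigma> X s \<le> max_info_gain k \<sigma> X t"
proof -
  obtain qs where qs: "set qs \<subseteq> X" "length qs = s" "max_info_gain k \<sigma> X s = info_gain k \<sigma> qs"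
    using max_info_gain_attained[OF assms(1,2)] .
  obtain v where v: "v \<in> X" using assms by auto
  let ?rs = "replicate (t - s) v"
  have "info_gain k \<sigma> qs \<le> info_gain k \<sigma> (qs @ ?rs)"
    using qs v by (intro info_gain_append_ge) auto
  also have "\<dots> \<le> max_info_gain k \<sigma> X (length (qs @ ?rs))"
    using qs v assms by (intro max_info_gain_ge) auto
  finally show ?thesis using qs assms by simp
qed

text \<open>The bound is the information of a single observation at a point of prior variance 1. It
  allows the regret of batch 1 to be absorbed into a bound proportional to
  \<open>sqrt \<gamma>\<close>.\<close>

lemma max_info_gain_lower:
  assumes "finite X" "X \<noteq> {}" "t \<ge> 1" and diag: "\<And>v. v \<in> X \<Longrightarrow> k v v = 1"
  shows "1 / 2 * ln (1 + 1 / \<sigma>\<^sup>2) \<le> max_info_gain k \<sigma> X t"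
proof -
  obtain v where v: "v \<in> X" using assms by auto
  have "info_gain k \<sigma> ([] @ [v]) = info_gain k \<sigma> [] + 1 / 2 * ln (1 + post_var [] v / \<sigma>\<^sup>2)"
    using v by (intro info_gain_snoc) auto
  then have "1 / 2 * ln (1 + 1 / \<sigma>\<^sup>2) = info_gain k \<sigma> [v]"
    using diag[OF v] by (simp add: info_gain_def[of _ _ "[]"] kernel_mat_def post_var_def)
  also have "\<dots> \<le> max_info_gain k \<sigma> X 1"
    using max_info_gain_ge[of X "[v]" k \<sigma>] v assms by simp
  also have "\<dots> \<le> max_info_gain k \<sigma> X t"
    by (rule max_info_gain_mono) (use assms in auto)
  finally show ?thesis .
qed

end


subsection \<open>Batch sizes\<close>

lemma batch_size_eq:
  "batch_size a T i = min (nat \<lceil>real T powr (1 - a ^ i)\<rceil>) (T - batch_start a T i)"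
  unfolding batch_start_def by (rule batch_size.simps)

lemma batch_start_1 [simp]: "batch_start a T 1 = 0" "batch_start a T (Suc 0) = 0"
  by (simp_all add: batch_start_def)

lemma batch_start_Suc: "i \<ge> 1 \<Longrightarrow> batch_start a T (Suc i) = batch_start a T i + batch_size a T i"
  by (simp add: batch_start_def)

lemma batch_start_Suc_sum: "batch_start a T (Suc m) = (\<Sum>i=1..m. batch_size a T i)"
  by (simp add: batch_start_def atLeastLessThanSuc_atLeastAtMost)

lemma batch_start_le: "batch_start a T i \<le> T"
proof (induction i)
  case (Suc i)
  then show ?case
    by (cases "i = 0") (auto simp: batch_start_Suc batch_size_eq)
qed (simp add: batch_start_def)

lemma batch_size_le_T: "batch_size a T i \<le> T"
  by (simp add: batch_size_eq)

lemma sum_upto_batch_start: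
  fixes g :: "nat \<Rightarrow> 'b::comm_monoid_add"
  shows "(\<Sum>t=1..batch_start a T (Suc m). g t)
    = (\<Sum>i=1..m. \<Sum>j=1..batch_size a T i. g (batch_start a T i + j))"
proof (induction m)
  case (Suc m)
  let ?s = "batch_start a T (Suc m)" and ?N = "batch_size a T (Suc m)"
  have "(\<Sum>t=1..batch_start a T (Suc (Suc m)). g t) = (\<Sum>t=1..?s + ?N. g t)"
    by (simp add: batch_start_Suc)
  also have "\<dots> = (\<Sum>t=1..?s. g t) + (\<Sum>t=Suc ?s..?s + ?N. g t)"
    using sum.ub_add_nat[of 1 ?s g ?N] by simp
  also have "(\<Sum>t=Suc ?s..?s + ?N. g t) = (\<Sum>j=1..?N. g (?s + j))"
    using sum.shift_bounds_cl_nat_ivl[of g 1 ?s ?N] by (simp add: add.commute)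
  finally show ?case using Suc by simp
qed simp

context
  fixes a :: real and T :: nat
  assumes a: "0 < a" "a < 1" and T: "T \<ge> 1"
begin

lemma powr_ge_1: "1 \<le> real T powr (1 - a ^ i)"
  using a T by (intro ge_one_powr_ge_zero) (auto simp: power_le_one)

text \<open>Until the horizon is exhausted every batch contains at least one step. So
  \<open>T\<close> batches always suffice, and the \<open>LEAST\<close> in
  \<open>num_batches\<close> is attained.\<close>

lemma batch_start_ge: "min T i \<le> batch_start a T (Suc i)"
proof (induction i)
  case (Suc i)
  have "1 \<le> nat \<lceil>real T powr (1 - a ^ Suc i)\<rceil>"
    using powr_ge_1[of "Suc i"] by linarith
  then have "min 1 (T - batch_start a T (Suc i)) \<le> batch_size a T (Suc i)"
    unfolding batch_size_eq[of a T "Suc i"] by linarith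
  then show ?case using Suc batch_start_le[of a T "Suc i"] batch_start_Suc[of "Suc i" a T] by auto
qed simp

lemma batch_start_num_batches: "batch_start a T (Suc (num_batches a T)) = T"
proof -
  have "(\<Sum>i=1..T. batch_size a T i) = T"
    using batch_start_ge[of T] batch_start_le[of a T "Suc T"] by (simp add: batch_start_Suc_sum)
  then show ?thesis
    unfolding batch_start_Suc_sum num_batches_def by (rule LeastI)
qed

lemma num_batches_ge_1: "num_batches a T \<ge> 1"
  using batch_start_num_batches T by (cases "num_batches a T") auto

lemma batch_start_less:
  assumes "i < num_batches a T"
  shows "batch_start a T (Suc i) < T"
  using not_less_Least[of i "\<lambda>B. (\<Sum>i=1..B. batch_size a T i) = T"] assms
    batch_start_le[of a T "Suc i"]
  unfolding num_batches_def[symmetric] batch_start_Suc_sum by auto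

text \<open>A batch cut by the horizon would use up all remaining steps, which by minimality of
  \<open>num_batches\<close> cannot happen before the last batch.\<close>

lemma batch_size_inner:
  assumes "1 \<le> i" "i < num_batches a T"
  shows "batch_size a T i = nat \<lceil>real T powr (1 - a ^ i)\<rceil>"
  using batch_start_less[OF assms(2)] batch_start_Suc[OF assms(1), of a T]
  by (auto simp: batch_size_eq)

lemma batch_size_inner_ge:
  assumes "1 \<le> i" "i < num_batches a T"
  shows "real T powr (1 - a ^ i) \<le> real (batch_size a T i)"
  unfolding batch_size_inner[OF assms] by linarith

lemma batch_size_inner_ge_1:
  assumes "1 \<le> i" "i < num_batches a T"
  shows "1 \<le> batch_size a T i"
  using batch_size_inner_ge[OF assms] powr_ge_1[of i] by linarith

text \<open>Rounding up adds less than 1, and the power itself is at least 1; this is the origin of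
  the factor 2.\<close>

lemma batch_size_le: "real (batch_size a T i) \<le> 2 * real T powr (1 - a ^ i)"
proof -
  have "batch_size a T i \<le> nat \<lceil>real T powr (1 - a ^ i)\<rceil>"
    by (simp add: batch_size_eq)
  then show ?thesis using powr_ge_1[of i] by linarith
qed

lemma ex_batch_of_time:
  assumes "t \<in> {1..T}"
  obtains i j where "i \<in> {1..num_batches a T}" "j \<in> {1..batch_size a T i}"
    "t = batch_start a T i + j"
proof -
  define P where "P i \<longleftrightarrow> i \<ge> 1 \<and> t \<le> batch_start a T (Suc i)" for i
  have P: "P (num_batches a T)"
    using assms num_batches_ge_1 batch_start_num_batches by (simp add: P_def)
  define i where "i = (LEAST i. P i)"
  have "P i" unfolding i_def using P by (rule LeastI)
  have "i \<le> num_batches a T" unfolding i_def using P by (rule Least_le)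
  moreover have "batch_start a T i < t"
  proof (cases "i = 1")
    case False
    have "i \<ge> 1" using \<open>P i\<close> by (simp add: P_def)
    then have "i - 1 < i" by simp
    then have "\<not> P (i - 1)" unfolding i_def by (rule not_less_Least)
    then show ?thesis using \<open>i \<ge> 1\<close> False by (simp add: P_def not_le)
  qed (use assms in simp)
  ultimately show ?thesis
    using \<open>P i\<close> batch_start_Suc[of i a T]
    by (intro that[of i "t - batch_start a T i"]) (auto simp: P_def)
qed

text \<open>Once \<open>a ^ i * ln T < 1\<close>, batch \<open>i\<close> has at least \<open>T / e\<close> steps, and \<open>e \<le> 3\<close>.\<close>

lemma card_late_batches:
  "card {i \<in> {1..<num_batches a T}. a ^ i * ln (real T) < 1} \<le> 3"
proof -
  let ?I = "{i \<in> {1..<num_batches a T}. a ^ i * ln (real T) < 1}"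
  have "real (card ?I) * (real T / exp 1) = (\<Sum>i\<in>?I. real T / exp 1)" by simp
  also have "\<dots> \<le> (\<Sum>i\<in>?I. real (batch_size a T i))"
  proof (rule sum_mono)
    fix i assume i: "i \<in> ?I"
    have "real T / exp 1 = real T powr 1 * exp (- 1)"
      using T by (simp add: exp_minus field_simps)
    also have "\<dots> \<le> real T powr 1 * exp (- (a ^ i * ln (real T)))"
      using i by (intro mult_left_mono) auto
    also have "\<dots> = real T powr (1 - a ^ i)"
      using T by (simp add: powr_def exp_diff exp_minus left_diff_distrib field_simps)
    also have "\<dots> \<le> real (batch_size a T i)" using i by (intro batch_size_inner_ge) auto
    finally show "real T / exp 1 \<le> real (batch_size a T i)" .
  qed
  also have "\<dots> \<le> (\<Sum>i=1..num_batches a T. real (batch_size a T i))"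
    by (rule sum_mono2) auto
  also have "\<dots> = real T"
    using batch_start_num_batches unfolding batch_start_Suc_sum by (metis of_nat_sum)
  finally have "real (card ?I) \<le> exp 1" using T by (simp add: field_simps)
  then show ?thesis using exp_le by linarith
qed

text \<open>The summands are \<open>T powr (- c * a ^ i)\<close>. The at most three late batches
  contribute at most 1 each. For the earlier ones \<open>exp (- t) \<le> 1 / t\<close> is used: at
  the last early index \<open>m\<close> still \<open>a ^ m * ln T \<ge> 1\<close>, so going back
  from \<open>m\<close> the terms are dominated by the geometric series
  \<open>a ^ (m - i) / c\<close>.\<close>

lemma sum_exp_neg_le:
  assumes c: "c > 0"
  shows "(\<Sum>i\<in>{1..<num_batches a T}. exp (- (c * a ^ i * ln (real T)))) \<le> 3 + 1 / (c * (1 - a))"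
proof -
  let ?B = "{1..<num_batches a T}"
  let ?L = "ln (real T)"
  let ?I = "{i \<in> ?B. a ^ i * ?L < 1}" and ?J = "{i \<in> ?B. \<not> a ^ i * ?L < 1}"
  let ?h = "\<lambda>i. exp (- (c * a ^ i * ?L))"
  have L: "?L \<ge> 0" using T by simp
  have "(\<Sum>i\<in>?B. ?h i) = (\<Sum>i\<in>?I \<union> ?J. ?h i)" by (rule sum.cong) auto
  also have "\<dots> = (\<Sum>i\<in>?I. ?h i) + (\<Sum>i\<in>?J. ?h i)"
    by (rule sum.union_disjoint) auto
  also have "(\<Sum>i\<in>?I. ?h i) \<le> (\<Sum>i\<in>?I. 1)"
    using c a L by (intro sum_mono) simp
  also have "\<dots> \<le> 3" using card_late_batches by simp
  also have "(\<Sum>i\<in>?J. ?h i) \<le> 1 / (c * (1 - a))"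
  proof (cases "?J = {}")
    case True
    then show ?thesis using c a by (simp only: sum.empty) simp
  next
    case False
    define m where "m = Max ?J"
    have m: "m \<in> ?J" unfolding m_def using False by (intro Max_in) auto
    have le: "i \<le> m" if "i \<in> ?J" for i unfolding m_def using that by (intro Max_ge) auto
    have "(\<Sum>i\<in>?J. ?h i) \<le> (\<Sum>i\<in>?J. a ^ (m - i) / c)"
    proof (rule sum_mono)
      fix i assume i: "i \<in> ?J"
      have pos: "a ^ i * ?L > 0" using i by (auto simp: not_less intro: less_le_trans[of 0 1])
      have "1 + c * a ^ i * ?L \<le> exp (c * a ^ i * ?L)" by (rule exp_ge_add_one_self)
      then have "c * a ^ i * ?L \<le> exp (c * a ^ i * ?L)" by linarith
      then have "c * (a ^ i * ?L) \<le> exp (c * a ^ i * ?L)" by (simp only: mult.assoc)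
      then have "?h i \<le> 1 / (c * (a ^ i * ?L))"
        using c pos unfolding exp_minus inverse_eq_divide by (intro divide_left_mono) auto
      also have "\<dots> \<le> a ^ (m - i) / c"
      proof -
        have "1 \<le> a ^ m * ?L" using m by simp
        also have "\<dots> = a ^ (m - i) * (a ^ i * ?L)"
          using le[OF i] by (simp add: power_add[symmetric] mult.assoc[symmetric])
        finally show ?thesis using c pos by (simp add: field_simps)
      qed
      finally show "?h i \<le> a ^ (m - i) / c" .
    qed
    also have "\<dots> = (\<Sum>i\<in>?J. a ^ (m - i)) / c" by (simp add: sum_divide_distrib)
    also have "(\<Sum>i\<in>?J. a ^ (m - i)) = (\<Sum>n\<in>(\<lambda>i. m - i) ` ?J. a ^ n)"
    proof -
      have "inj_on (\<lambda>i. m - i) ?J"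
        using le by (intro inj_onI) (metis diff_diff_cancel)
      then show ?thesis by (simp only: sum.reindex o_def)
    qed
    also have "\<dots> \<le> (\<Sum>n. a ^ n)"
      using a by (intro sum_le_suminf summable_geometric) auto
    also have "\<dots> = 1 / (1 - a)" using a by (intro suminf_geometric) auto
    finally show ?thesis using c by (simp add: field_simps divide_right_mono)
  qed
  finally show ?thesis by simp
qed

text \<open>An early batch has \<open>a ^ i * ln T \<ge> 1\<close>, hence
  \<open>i \<le> ln (ln T) / ln (1 / a)\<close>. The 4 counts three late batches and the last batch,
  which lies outside the index range.\<close>

lemma num_batches_le:
  assumes L: "ln (real T) \<ge> 1"
  shows "real (num_batches a T) \<le> 4 + ln (ln (real T)) / ln (1 / a)"
proof -
  let ?B = "{1..<num_batches a T}"
  let ?L = "ln (real T)"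
  let ?y = "ln ?L / ln (1 / a)"
  let ?I = "{i \<in> ?B. a ^ i * ?L < 1}" and ?J = "{i \<in> ?B. \<not> a ^ i * ?L < 1}"
  have la: "ln (1 / a) > 0" using a by simp
  have y: "?y \<ge> 0" using L la by simp
  have "?J \<subseteq> {1..nat \<lfloor>?y\<rfloor>}"
  proof
    fix i assume i: "i \<in> ?J"
    then have "0 \<le> ln (a ^ i * ?L)" by simp
    also have "\<dots> = ln ?L - real i * ln (1 / a)"
      using a L by (simp add: ln_mult ln_realpow ln_div)
    finally have "real i \<le> ?y" using la by (simp add: field_simps)
    then show "i \<in> {1..nat \<lfloor>?y\<rfloor>}" using i by (simp add: le_nat_floor)
  qed
  then have "card ?J \<le> nat \<lfloor>?y\<rfloor>" using card_mono[of "{1..nat \<lfloor>?y\<rfloor>}" ?J] by simp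
  moreover have "card ?B \<le> card ?I + card ?J"
  proof -
    have "?B = ?I \<union> ?J" by blast
    then show ?thesis using card_Un_le[of ?I ?J] by argo
  qed
  ultimately have "num_batches a T \<le> 4 + nat \<lfloor>?y\<rfloor>" using card_late_batches by simp
  then show ?thesis using y by linarith
qed

text \<open>With \<open>y = ln (ln T)\<close> the threshold is chosen so that the bound
  \<open>4 + y / ln (1 / a)\<close> on the number of batches is at most \<open>y * y\<close>; the
  logarithm turns the square into the factor 2.\<close>

lemma ln_num_batches_le:
  assumes "ln (ln (real T)) \<ge> 4 + 1 / ln (1 / a)"
  shows "ln (real (num_batches a T)) \<le> 2 * ln (ln (ln (real T)))"
proof -
  let ?y = "ln (ln (real T))"
  have la: "ln (1 / a) > 0" using a by simp
  then have "1 / ln (1 / a) > 0" by simp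
  then have y: "?y \<ge> 4" using assms by linarith
  \<comment> \<open>Otherwise \<open>ln (real T) = 0\<close>, and the convention
    \<open>ln 0 = 0\<close> would contradict \<open>y \<ge> 4\<close>.\<close>
  have lT: "ln (real T) > 0"
  proof (rule ccontr)
    assume "\<not> 0 < ln (real T)"
    then have "ln (real T) = 0" using T by simp
    with y show False by simp
  qed
  then have "ln (real T) \<ge> 1" using y ln_ge_iff[of "ln (real T)" 4] exp_ge_add_one_self[of 4] by linarith
  from num_batches_le[OF this]
  have "real (num_batches a T) \<le> 4 + ?y * (1 / ln (1 / a))" by simp
  also have "\<dots> \<le> ?y * 4 + ?y * (1 / ln (1 / a))" using y by simp
  also have "\<dots> = ?y * (4 + 1 / ln (1 / a))" by (simp add: distrib_left)
  also have "\<dots> \<le> ?y * ?y" using assms y by (intro mult_left_mono) auto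
  finally have "ln (real (num_batches a T)) \<le> ln (?y * ?y)"
    using num_batches_ge_1 by (intro ln_mono) auto
  also have "\<dots> = 2 * ln ?y" using y by (simp add: ln_mult)
  finally show ?thesis .
qed

end


subsection \<open>Gaussian noise given the past\<close>

text \<open>The cross term \<open>- c * x\<close> of the expanded exponent is not positive.\<close>

lemma std_normal_density_shift_le:
  assumes "0 \<le> c * x"
  shows "std_normal_density (c + x) \<le> exp (- c\<^sup>2 / 2) * std_normal_density x"
proof -
  have "- (c + x)\<^sup>2 / 2 \<le> - c\<^sup>2 / 2 + - x\<^sup>2 / 2"
    using assms by (simp add: power2_sum diff_divide_distrib add_divide_distrib)
  then have "exp (- (c + x)\<^sup>2 / 2) \<le> exp (- c\<^sup>2 / 2) * exp (- x\<^sup>2 / 2)"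
    unfolding exp_add[symmetric] by (subst exp_le_cancel_iff)
  from mult_left_mono[OF this, of "1 / sqrt (2 * pi)"] show ?thesis
    unfolding std_normal_density_def by (simp only: mult.assoc mult.left_commute) simp
qed

text \<open>Translating each of the two tails to the corresponding half line avoids the factor \<open>2\<close> that
  a union bound over the two tails would cost.\<close>

lemma nn_integral_std_normal_tails_le:
  assumes "c \<ge> 0"
  shows "(\<integral>\<^sup>+x. ennreal (std_normal_density x) * indicator {x. \<bar>x\<bar> > c} x \<partial>lborel)
    \<le> ennreal (exp (- c\<^sup>2 / 2))"
proof -
  let ?\<phi> = "\<lambda>x. ennreal (std_normal_density x)"
  let ?e = "exp (- c\<^sup>2 / 2)"
  have "(\<integral>\<^sup>+x. ?\<phi> x * indicator {x. \<bar>x\<bar> > c} x \<partial>lborel)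
      = (\<integral>\<^sup>+x. ?\<phi> x * indicator {c<..} x + ?\<phi> x * indicator {..<-c} x \<partial>lborel)"
    using assms by (intro nn_integral_cong) (auto simp: indicator_def)
  also have "\<dots> = (\<integral>\<^sup>+x. ?\<phi> x * indicator {c<..} x \<partial>lborel) + (\<integral>\<^sup>+x. ?\<phi> x * indicator {..<-c} x \<partial>lborel)"
    by (rule nn_integral_add) auto
  also have "(\<integral>\<^sup>+x. ?\<phi> x * indicator {c<..} x \<partial>lborel) = (\<integral>\<^sup>+x. ?\<phi> (c + x) * indicator {0<..} x \<partial>lborel)"
    by (subst nn_integral_real_affine[where c = 1 and t = c])
      (auto simp: indicator_def intro!: nn_integral_cong)
  also have "(\<integral>\<^sup>+x. ?\<phi> x * indicator {..<-c} x \<partial>lborel) = (\<integral>\<^sup>+x. ?\<phi> (- c + x) * indicator {..<0} x \<partial>lborel)"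
    by (subst nn_integral_real_affine[where c = 1 and t = "-c"])
      (auto simp: indicator_def intro!: nn_integral_cong)
  also have "(\<integral>\<^sup>+x. ?\<phi> (c + x) * indicator {0<..} x \<partial>lborel)
        + (\<integral>\<^sup>+x. ?\<phi> (- c + x) * indicator {..<0} x \<partial>lborel)
      = (\<integral>\<^sup>+x. ?\<phi> (c + x) * indicator {0<..} x + ?\<phi> (- c + x) * indicator {..<0} x \<partial>lborel)"
    by (rule nn_integral_add[symmetric]) auto
  also have "\<dots> \<le> (\<integral>\<^sup>+x. ennreal ?e * ?\<phi> x \<partial>lborel)"
  proof (rule nn_integral_mono)
    fix x :: real
    have "?\<phi> (c + x) \<le> ennreal ?e * ?\<phi> x" if "x > 0"
      using assms that by (subst ennreal_mult'[symmetric])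
        (use std_normal_density_shift_le[of c x] in \<open>auto intro!: ennreal_leI\<close>)
    moreover have "?\<phi> (- c + x) \<le> ennreal ?e * ?\<phi> x" if "x < 0"
      using assms that std_normal_density_shift_le[of "- c" x]
      by (subst ennreal_mult'[symmetric]) (auto intro!: ennreal_leI simp: mult_nonneg_nonpos)
    ultimately show "?\<phi> (c + x) * indicator {0<..} x + ?\<phi> (- c + x) * indicator {..<0} x \<le> ennreal ?e * ?\<phi> x"
      by (cases "x > 0"; cases "x < 0") (simp_all add: indicator_def)
  qed
  also have "\<dots> = ennreal ?e * (\<integral>\<^sup>+x. ?\<phi> x \<partial>lborel)"
    by (rule nn_integral_cmult) auto
  also have "(\<integral>\<^sup>+x. ?\<phi> x \<partial>lborel) = 1"
    using prob_space.emeasure_space_1[OF prob_space_normal_density[of 1 0]]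
    by (simp add: emeasure_density cong: nn_integral_cong)
  finally show ?thesis by simp
qed

context prob_space
begin

lemma normal_tails_le:
  assumes X: "distributed M lborel X (normal_density 0 s)" and "s > 0" "c \<ge> 0"
  shows "prob {\<omega> \<in> space M. \<bar>X \<omega>\<bar> > c * s} \<le> exp (- c\<^sup>2 / 2)"
proof -
  let ?Y = "\<lambda>\<omega>. (X \<omega> - 0) / s"
  have Y: "distributed M lborel ?Y std_normal_density"
    using normal_standard_normal_convert[OF \<open>s > 0\<close>, of X 0] X by simp
  have "{\<omega> \<in> space M. \<bar>X \<omega>\<bar> > c * s} = ?Y -` {x. \<bar>x\<bar> > c} \<inter> space M"
    using \<open>s > 0\<close> by (auto simp: abs_div_pos[symmetric] field_simps)
  then have "emeasure M {\<omega> \<in> space M. \<bar>X \<omega>\<bar> > c * s}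
      = (\<integral>\<^sup>+x. ennreal (std_normal_density x) * indicator {x. \<bar>x\<bar> > c} x \<partial>lborel)"
    using distributed_emeasure[OF Y, of "{x. \<bar>x\<bar> > c}"] by simp
  also have "\<dots> \<le> ennreal (exp (- c\<^sup>2 / 2))"
    using \<open>c \<ge> 0\<close> by (rule nn_integral_std_normal_tails_le)
  finally show ?thesis by (simp add: emeasure_eq_measure)
qed

end

section \<open>Noise conditioned on an event of the past, independently of the algorithm\<close>

locale adapted_noise = prob_space M for M :: "'w measure" +
  fixes F :: "nat \<Rightarrow> 'w measure" and z :: "nat \<Rightarrow> 'w \<Rightarrow> real" and \<sigma> :: real and T :: nat
  assumes sub_F: "\<And>t. subalgebra M (F t)"
    and mono_F: "\<And>s t. s \<le> t \<Longrightarrow> sets (F s) \<subseteq> sets (F t)"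
    and noise_normal: "\<And>t. t \<in> {1..T} \<Longrightarrow> distributed M lborel (z t) (normal_density 0 \<sigma>)"
    and noise_adapted: "\<And>t. t \<in> {1..T} \<Longrightarrow> z t \<in> borel_measurable (F t)"
    and noise_indep: "\<And>t. t \<in> {1..T} \<Longrightarrow>
          indep_set (sets (F (t - 1))) {z t -` A \<inter> space M | A. A \<in> sets borel}"
begin

lemma space_F: "space (F t) = space M"
  using sub_F[of t] by (simp add: subalgebra_def)

lemma sets_F: "A \<in> sets (F t) \<Longrightarrow> A \<in> events"
  using sub_F[of t] by (auto simp: subalgebra_def)

lemma noise_measurable: "t \<in> {1..T} \<Longrightarrow> z t \<in> borel_measurable M"
  using noise_normal[of t] by (auto dest: distributed_measurable)

text \<open>Membership in \<open>F (s + m)\<close> is carried through the induction because the next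
  noise term is independent of exactly these events. Each step then contributes one factor.\<close>

lemma prob_past_Int_noise:
  assumes A: "A \<in> sets (F s)" and m: "s + m \<le> T" and B: "\<And>j. B j \<in> sets borel"
  shows "A \<inter> {\<omega> \<in> space M. \<forall>j<m. z (s + Suc j) \<omega> \<in> B j} \<in> sets (F (s + m)) \<and>
    prob (A \<inter> {\<omega> \<in> space M. \<forall>j<m. z (s + Suc j) \<omega> \<in> B j})
      = prob A * (\<Prod>j<m. prob (z (s + Suc j) -` B j \<inter> space M))"
  using m
proof (induction m)
  case 0
  have "A \<inter> space M = A" using sets.sets_into_space[OF A] by (auto simp: space_F)
  then show ?case using A by simp
next
  case (Suc m)
  let ?E = "\<lambda>m. A \<inter> {\<omega> \<in> space M. \<forall>j<m. z (s + Suc j) \<omega> \<in> B j}"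
  let ?t = "s + Suc m"
  have t: "?t \<in> {1..T}" using Suc.prems by simp
  have E: "?E (Suc m) = ?E m \<inter> (z ?t -` B m \<inter> space M)" by (auto simp: less_Suc_eq)
  have Em: "?E m \<in> sets (F (s + m))"
    and prob_Em: "prob (?E m) = prob A * (\<Prod>j<m. prob (z (s + Suc j) -` B j \<inter> space M))"
    using Suc by simp_all
  have "?E m \<in> sets (F ?t)" using Em mono_F[of "s + m" ?t] by auto
  moreover have "z ?t -` B m \<inter> space M \<in> sets (F ?t)"
    using measurable_sets[OF noise_adapted[OF t] B[of m]] by (simp only: space_F)
  ultimately have "?E (Suc m) \<in> sets (F ?t)" unfolding E by (rule sets.Int)
  moreover have "prob (?E m \<inter> (z ?t -` B m \<inter> space M)) = prob (?E m) * prob (z ?t -` B m \<inter> space M)"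
  proof (rule noise_indep[OF t, unfolded indep_sets2_eq, THEN conjunct2, THEN conjunct2, rule_format])
    show "?E m \<in> sets (F (?t - 1))" using Em by (simp only: add_Suc_right diff_Suc_1)
    show "z ?t -` B m \<inter> space M \<in> {z ?t -` A \<inter> space M | A. A \<in> sets borel}"
      using B[of m] by blast
  qed
  then have "prob (?E (Suc m)) = prob A * (\<Prod>j<Suc m. prob (z (s + Suc j) -` B j \<inter> space M))"
    unfolding E prob_Em by (simp add: mult.assoc)
  ultimately show ?case by blast
qed

lemma prob_past_Int_noise_subset:
  assumes A: "A \<in> sets (F s)" and m: "s + m \<le> T" and J: "J \<subseteq> {..<m}"
    and B: "\<And>j. j \<in> J \<Longrightarrow> B j \<in> sets borel"
  shows "prob (A \<inter> {\<omega> \<in> space M. \<forall>j\<in>J. z (s + Suc j) \<omega> \<in> B j})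
      = prob A * (\<Prod>j\<in>J. prob (z (s + Suc j) -` B j \<inter> space M))"
proof -
  \<comment> \<open>Indices outside \<open>J\<close> are left unconstrained and contribute the
    factor 1.\<close>
  let ?B = "\<lambda>j. if j \<in> J then B j else UNIV"
  have "{\<omega> \<in> space M. \<forall>j\<in>J. z (s + Suc j) \<omega> \<in> B j} = {\<omega> \<in> space M. \<forall>j<m. z (s + Suc j) \<omega> \<in> ?B j}"
    using J by auto
  moreover have "(\<Prod>j<m. prob (z (s + Suc j) -` ?B j \<inter> space M))
      = (\<Prod>j\<in>J. prob (z (s + Suc j) -` B j \<inter> space M))"
    using J by (intro prod.mono_neutral_cong_right) (auto simp: prob_space)
  ultimately show ?thesis
    using prob_past_Int_noise[OF A m, of ?B] B by simp
qed

text \<open>Conditioning is expressed by a change of measure, so that results on sums of independent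
  normals apply to the conditional law. The product formula yields both claims: with a single index
  it shows that the marginals are unchanged, with several that the noise terms stay
  independent.\<close>

lemma noise_given_past:
  assumes A: "A \<in> sets (F s)" and pos: "prob A > 0" and n: "s + n \<le> T"
  defines "M' \<equiv> uniform_measure M A"
  shows "prob_space M'"
    and "prob_space.indep_vars M' (\<lambda>_. borel) (\<lambda>j. z (s + Suc j)) {..<n}"
    and "\<And>j. j < n \<Longrightarrow> distributed M' lborel (z (s + Suc j)) (normal_density 0 \<sigma>)"
proof -
  have AM: "A \<in> events" using A by (rule sets_F)
  have ne: "emeasure M A \<noteq> 0" "emeasure M A \<noteq> \<infinity>"
    using pos by (auto simp: emeasure_eq_measure)
  show ps: "prob_space M'" unfolding M'_def using ne by (rule prob_space_uniform_measure)
  interpret P: prob_space M' by (rule ps)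
  have [simp]: "sets M' = events" "space M' = space M" by (simp_all add: M'_def)
  have meas: "g \<in> measurable M' N \<longleftrightarrow> g \<in> measurable M N" for g :: "'w \<Rightarrow> real" and N
    by (simp add: measurable_def)
  have rv: "z (s + Suc j) \<in> borel_measurable M" if "j < n" for j
    using that n by (intro noise_measurable) auto
  have P: "P.prob E = prob (A \<inter> E) / prob A" if "E \<in> events" for E
    unfolding M'_def using ne AM that by (simp add: measure_uniform_measure)
  have joint: "P.prob {\<omega> \<in> space M. \<forall>j\<in>J. z (s + Suc j) \<omega> \<in> B j}
      = (\<Prod>j\<in>J. prob (z (s + Suc j) -` B j \<inter> space M))"
    if J: "J \<subseteq> {..<n}" and B: "\<And>j. j \<in> J \<Longrightarrow> B j \<in> sets borel" for J B
  proof -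
    have "finite J" using J by (rule finite_subset) simp
    have "{\<omega> \<in> space M. \<forall>j\<in>J. z (s + Suc j) \<omega> \<in> B j} \<in> events"
    proof (rule sets.sets_Collect_finite_All)
      fix j assume "j \<in> J"
      then have "z (s + Suc j) -` B j \<inter> space M \<in> events"
        using J by (intro measurable_sets[OF rv B]) auto
      also have "z (s + Suc j) -` B j \<inter> space M = {\<omega> \<in> space M. z (s + Suc j) \<omega> \<in> B j}"
        by auto
      finally show "{\<omega> \<in> space M. z (s + Suc j) \<omega> \<in> B j} \<in> events" .
    qed fact
    from P[OF this] show ?thesis
      using pos prob_past_Int_noise_subset[OF A n J B] by simp
  qed
  have marg: "P.prob (z (s + Suc j) -` B \<inter> space M) = prob (z (s + Suc j) -` B \<inter> space M)"
    if "j < n" "B \<in> sets borel" for j B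
  proof -
    have "{\<omega> \<in> space M. \<forall>j\<in>{j}. z (s + Suc j) \<omega> \<in> B} = z (s + Suc j) -` B \<inter> space M" by auto
    then show ?thesis using joint[of "{j}" "\<lambda>_. B"] that by simp
  qed
  show "P.indep_vars (\<lambda>_. borel) (\<lambda>j. z (s + Suc j)) {..<n}"
    unfolding P.indep_vars_def2
  proof (intro conjI ballI P.indep_setsI)
    fix E J assume J: "J \<noteq> {}" "J \<subseteq> {..<n}" "finite J"
      and E: "\<forall>j\<in>J. E j \<in> {z (s + Suc j) -` A \<inter> space M' |A. A \<in> sets borel}"
    then have "\<forall>j\<in>J. \<exists>C. C \<in> sets borel \<and> E j = z (s + Suc j) -` C \<inter> space M" by auto
    from bchoice[OF this] obtain B where B: "\<And>j. j \<in> J \<Longrightarrow> B j \<in> sets borel"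
      "\<And>j. j \<in> J \<Longrightarrow> E j = z (s + Suc j) -` B j \<inter> space M"
      by blast
    have "(\<Inter>j\<in>J. E j) = {\<omega> \<in> space M. \<forall>j\<in>J. z (s + Suc j) \<omega> \<in> B j}"
      using J B(2) by auto
    then have "P.prob (\<Inter>j\<in>J. E j) = (\<Prod>j\<in>J. prob (z (s + Suc j) -` B j \<inter> space M))"
      using joint[OF J(2) B(1)] by simp
    also have "\<dots> = (\<Prod>j\<in>J. P.prob (E j))"
    proof (intro prod.cong refl)
      fix j assume j: "j \<in> J"
      then have "j < n" using J by auto
      then show "prob (z (s + Suc j) -` B j \<inter> space M) = P.prob (E j)"
        by (simp only: B(2)[OF j] marg[OF _ B(1)[OF j]])
    qed
    finally show "P.prob (\<Inter>j\<in>J. E j) = (\<Prod>j\<in>J. P.prob (E j))" .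
  next
    fix j assume "j \<in> {..<n}"
    then have j: "z (s + Suc j) \<in> borel_measurable M" using rv by blast
    then show "z (s + Suc j) \<in> borel_measurable M'" by (simp only: meas)
    show "{z (s + Suc j) -` A \<inter> space M' |A. A \<in> sets borel} \<subseteq> P.events"
      using measurable_sets[OF j] by auto
  qed
  show "distributed M' lborel (z (s + Suc j)) (normal_density 0 \<sigma>)" if j: "j < n" for j
  proof -
    have D: "distributed M lborel (z (s + Suc j)) (normal_density 0 \<sigma>)"
      using j n by (intro noise_normal) auto
    have "distr M' lborel (z (s + Suc j)) = distr M lborel (z (s + Suc j))"
    proof (rule measure_eqI)
      fix B assume "B \<in> sets (distr M' lborel (z (s + Suc j)))"
      then have B: "B \<in> sets borel" by simp
      have "z (s + Suc j) \<in> measurable M' lborel" "z (s + Suc j) \<in> measurable M lborel"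
        using rv[OF j] by (simp_all add: meas)
      then show "emeasure (distr M' lborel (z (s + Suc j))) B = emeasure (distr M lborel (z (s + Suc j))) B"
        using B marg[OF j B] by (simp add: emeasure_distr P.emeasure_eq_measure emeasure_eq_measure)
    qed simp
    then show ?thesis
      using D rv[OF j] by (simp add: distributed_def meas)
  qed
qed

text \<open>Under the conditional measure the combination is centred normal with variance
  \<open>\<sigma>\<^sup>2 * (\<Sum>j<n. (w j)\<^sup>2)\<close>, so \<open>d\<close> dominates its
  standard deviation. Multiplying by \<open>prob A\<close> returns to the original measure.\<close>

lemma noise_combination_tails_le:
  assumes A: "A \<in> sets (F s)" and n: "s + n \<le> T" and "\<sigma> > 0" "c \<ge> 0" "d \<ge> 0"
    and d: "\<sigma>\<^sup>2 * (\<Sum>j<n. (w j)\<^sup>2) \<le> d\<^sup>2"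
  shows "prob (A \<inter> {\<omega> \<in> space M. \<bar>\<Sum>j<n. w j * z (s + Suc j) \<omega>\<bar> > c * d}) \<le> prob A * exp (- c\<^sup>2 / 2)"
\<comment> \<open>Two degenerate cases: a null event cannot be conditioned on, and a combination
  with zero coefficients has no density, but then the strict inequality makes the event
  empty.\<close>
proof (cases "prob A = 0 \<or> (\<forall>j<n. w j = 0)")
  case True
  then show ?thesis
  proof
    assume "prob A = 0"
    moreover have "prob (A \<inter> {\<omega> \<in> space M. \<bar>\<Sum>j<n. w j * z (s + Suc j) \<omega>\<bar> > c * d}) \<le> prob A"
      using sets_F[OF A] by (intro finite_measure_mono) auto
    ultimately show ?thesis by simp
  next
    assume "\<forall>j<n. w j = 0"
    then have "{\<omega> \<in> space M. \<bar>\<Sum>j<n. w j * z (s + Suc j) \<omega>\<bar> > c * d} = {}"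
      using assms by (auto simp: not_less)
    then show ?thesis by (simp only: Int_empty_right measure_empty) simp
  qed
next
  case False
  then have pos: "prob A > 0" by (simp add: zero_less_measure_iff)
  define M' where "M' = uniform_measure M A"
  note given = noise_given_past[OF A pos n, folded M'_def]
  interpret P: prob_space M' by (rule given(1))
  have AM: "A \<in> events" using A by (rule sets_F)
  have [simp]: "sets M' = events" "space M' = space M" by (simp_all add: M'_def)
  \<comment> \<open>Zero coefficients are dropped, since each summand needs a positive standard
    deviation to have a normal density.\<close>
  define J where "J = {j. j < n \<and> w j \<noteq> 0}"
  have J: "J \<noteq> {}" "finite J" "J \<subseteq> {..<n}" using False by (auto simp: J_def)
  let ?v = "sqrt (\<Sum>j\<in>J. (\<bar>w j\<bar> * \<sigma>)\<^sup>2)"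
  have vpos: "?v > 0"
    using J \<open>\<sigma> > 0\<close> by (intro real_sqrt_gt_zero sum_pos) (auto simp: J_def)
  have "distributed M' lborel (\<lambda>\<omega>. \<Sum>j\<in>J. w j * z (s + Suc j) \<omega>) (normal_density (\<Sum>j\<in>J. 0) ?v)"
  proof (rule P.sum_indep_normal)
    show "P.indep_vars (\<lambda>_. borel) (\<lambda>j \<omega>. w j * z (s + Suc j) \<omega>) J"
      using P.indep_vars_compose2[OF P.indep_vars_subset[OF given(2) J(3)], of "\<lambda>j x. w j * x" "\<lambda>_. borel"]
      by simp
    show "distributed M' lborel (\<lambda>\<omega>. w j * z (s + Suc j) \<omega>) (normal_density 0 (\<bar>w j\<bar> * \<sigma>))"
      if "j \<in> J" for j
      using P.normal_density_affine[OF given(3), of j "w j" 0] that \<open>\<sigma> > 0\<close> by (auto simp: J_def)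
  qed (use J \<open>\<sigma> > 0\<close> in \<open>auto simp: J_def\<close>)
  moreover have sumJ: "(\<Sum>j\<in>J. w j * z (s + Suc j) \<omega>) = (\<Sum>j<n. w j * z (s + Suc j) \<omega>)" for \<omega>
    by (rule sum.mono_neutral_left) (auto simp: J_def)
  ultimately have "distributed M' lborel (\<lambda>\<omega>. \<Sum>j<n. w j * z (s + Suc j) \<omega>) (normal_density 0 ?v)"
    by simp
  from P.normal_tails_le[OF this vpos \<open>c \<ge> 0\<close>]
  have tail: "P.prob {\<omega> \<in> space M. \<bar>\<Sum>j<n. w j * z (s + Suc j) \<omega>\<bar> > c * ?v} \<le> exp (- c\<^sup>2 / 2)"
    by simp
  have rv: "(\<lambda>\<omega>. \<Sum>j<n. w j * z (s + Suc j) \<omega>) \<in> borel_measurable M"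
    using n by (intro borel_measurable_sum borel_measurable_times noise_measurable) auto
  have "?v\<^sup>2 = (\<Sum>j\<in>J. (w j)\<^sup>2 * \<sigma>\<^sup>2)"
    by (simp add: sum_nonneg power_mult_distrib)
  also have "\<dots> = (\<Sum>j<n. (w j)\<^sup>2 * \<sigma>\<^sup>2)"
    by (rule sum.mono_neutral_left) (auto simp: J_def)
  also have "\<dots> = \<sigma>\<^sup>2 * (\<Sum>j<n. (w j)\<^sup>2)" by (simp add: sum_distrib_left mult.commute)
  also note d
  finally have "?v \<le> d" using \<open>d \<ge> 0\<close> by (rule power2_le_imp_le)
  then have "c * ?v \<le> c * d" using \<open>c \<ge> 0\<close> by (rule mult_left_mono)
  have set1: "{\<omega> \<in> space M. \<bar>\<Sum>j<n. w j * z (s + Suc j) \<omega>\<bar> > r} \<in> events" for r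
    using rv by measurable
  have "prob (A \<inter> {\<omega> \<in> space M. \<bar>\<Sum>j<n. w j * z (s + Suc j) \<omega>\<bar> > c * d}) / prob A
      = P.prob {\<omega> \<in> space M. \<bar>\<Sum>j<n. w j * z (s + Suc j) \<omega>\<bar> > c * d}"
    unfolding M'_def using pos AM set1
    by (subst measure_uniform_measure) (auto simp: emeasure_eq_measure)
  also have "\<dots> \<le> P.prob {\<omega> \<in> space M. \<bar>\<Sum>j<n. w j * z (s + Suc j) \<omega>\<bar> > c * ?v}"
    using \<open>c * ?v \<le> c * d\<close> set1 by (intro P.finite_measure_mono) auto
  also note tail
  finally show ?thesis using pos by (simp add: field_simps)
qed

end


subsection \<open>Interpolation error in the RKHS\<close>

context rkhs
begin

abbreviation feature :: "'a \<Rightarrow> 'a \<Rightarrow> real" where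
  "feature x \<equiv> on_set X (k x)"

lemma ip_feature: "x \<in> X \<Longrightarrow> y \<in> X \<Longrightarrow> ip (feature x) (feature y) = k x y"
  using reproducing[OF kernel_mem, of x y] by (simp add: on_set_def)

lemma sum_mem: "(\<And>r. r < (n::nat) \<Longrightarrow> g r \<in> H) \<Longrightarrow> (\<lambda>v. \<Sum>r<n. w r * g r v) \<in> H"
proof (induction n)
  case 0
  show ?case using zero_mem by (simp only: lessThan_0 sum.empty)
next
  case (Suc n)
  then have "(\<lambda>v. (\<Sum>r<n. w r * g r v) + w n * g n v) \<in> H"
    by (intro add_mem scale_mem) auto
  then show ?case by (simp only: sum.lessThan_Suc)
qed

lemma ip_zero_left: "h \<in> H \<Longrightarrow> ip (\<lambda>_. 0) h = 0"
  using ip_scale[OF zero_mem, of h 0] by simp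

lemma ip_sum_left:
  assumes "\<And>r. r < (n::nat) \<Longrightarrow> g r \<in> H" "h \<in> H"
  shows "ip (\<lambda>v. \<Sum>r<n. w r * g r v) h = (\<Sum>r<n. w r * ip (g r) h)"
  using assms
proof (induction n)
  case 0
  then show ?case using ip_zero_left by (simp only: lessThan_0 sum.empty)
next
  case (Suc n)
  have gn: "g n \<in> H" and mem: "(\<lambda>v. \<Sum>r<n. w r * g r v) \<in> H"
    using Suc.prems by (auto intro!: sum_mem)
  have "ip (\<lambda>v. (\<Sum>r<n. w r * g r v) + w n * g n v) h
      = ip (\<lambda>v. \<Sum>r<n. w r * g r v) h + w n * ip (g n) h"
    using ip_add[OF mem scale_mem[OF gn] Suc.prems(2)] ip_scale[OF gn Suc.prems(2)] by simp
  then show ?case using Suc by (simp only: sum.lessThan_Suc)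
qed

lemma Cauchy_Schwarz:
  assumes g: "g \<in> H" and h: "h \<in> H"
  shows "\<bar>ip g h\<bar> \<le> sqrt (ip g g) * sqrt (ip h h)"
proof (cases "ip h h = 0")
  case True
  then have "h = (\<lambda>_. 0)" using ip_definite h by blast
  then show ?thesis using ip_zero_left[OF g] ip_sym[OF g h] ip_nonneg[OF g] True by simp
next
  case False
  then have hh: "ip h h > 0" using ip_nonneg[OF h] by simp
  let ?c = "- (ip g h / ip h h)"
  \<comment> \<open>The component of \<open>g\<close> orthogonal to \<open>h\<close>; that its
    squared norm is nonnegative is the claim.\<close>
  let ?p = "\<lambda>v. g v + ?c * h v"
  have ch: "(\<lambda>v. ?c * h v) \<in> H" using h by (rule scale_mem)
  have p: "?p \<in> H" using g ch by (rule add_mem)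
  have "ip ?p h = ip g h + ?c * ip h h"
    using ip_add[OF g ch h] ip_scale[OF h h, of ?c] by simp
  then have ph: "ip ?p h = 0" using hh by simp
  have "ip ?p ?p = ip g ?p + ?c * ip h ?p"
    using ip_add[OF g ch p] ip_scale[OF h p, of ?c] by simp
  also have "ip h ?p = 0" using ph ip_sym[OF h p] by simp
  also have "ip g ?p = ip g g + ?c * ip g h"
    using ip_add[OF g ch g] ip_scale[OF h g, of ?c] ip_sym[OF g p] ip_sym[OF g h] by simp
  finally have "0 \<le> ip g g + ?c * ip g h" using ip_nonneg[OF p] by simp
  then have "(ip g h)\<^sup>2 \<le> ip g g * ip h h" using hh by (simp add: field_simps power2_eq_square)
  then have "sqrt ((ip g h)\<^sup>2) \<le> sqrt (ip g g * ip h h)" by (rule real_sqrt_le_mono)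
  then show ?thesis by (simp add: real_sqrt_mult)
qed

lemma ip_feature_sum:
  fixes w :: "nat \<Rightarrow> real"
  assumes "set qs \<subseteq> X"
  defines "h \<equiv> \<lambda>v. \<Sum>r<length qs. w r * feature (qs ! r) v"
  shows "h \<in> H" "ip h h = (\<Sum>r<length qs. \<Sum>s<length qs. w r * w s * k (qs ! r) (qs ! s))"
proof -
  have q: "qs ! r \<in> X" if "r < length qs" for r using assms that by auto
  then have mem: "feature (qs ! r) \<in> H" if "r < length qs" for r using that kernel_mem by blast
  then show h: "h \<in> H" unfolding h_def by (rule sum_mem)
  have "ip h h = (\<Sum>r<length qs. w r * ip (feature (qs ! r)) h)"
    unfolding h_def using mem h[unfolded h_def] by (rule ip_sum_left)
  also have "\<dots> = (\<Sum>r<length qs. w r * (\<Sum>s<length qs. w s * k (qs ! s) (qs ! r)))"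
  proof (intro sum.cong refl)
    fix r assume "r \<in> {..<length qs}"
    then have r: "r < length qs" by simp
    have "ip (feature (qs ! r)) h = ip h (feature (qs ! r))"
      using ip_sym[OF mem[OF r] h] .
    also have "\<dots> = (\<Sum>s<length qs. w s * ip (feature (qs ! s)) (feature (qs ! r)))"
      unfolding h_def using mem mem[OF r] by (rule ip_sum_left)
    also have "\<dots> = (\<Sum>s<length qs. w s * k (qs ! s) (qs ! r))"
      using q r by (intro sum.cong) (auto simp: ip_feature)
    finally show "w r * ip (feature (qs ! r)) h
      = w r * (\<Sum>s<length qs. w s * k (qs ! s) (qs ! r))" by simp
  qed
  also have "\<dots> = (\<Sum>s<length qs. \<Sum>r<length qs. w s * w r * k (qs ! s) (qs ! r))"
    by (subst sum.swap) (simp add: sum_distrib_left mult.left_commute mult.assoc)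
  finally show "ip h h = (\<Sum>r<length qs. \<Sum>s<length qs. w r * w s * k (qs ! r) (qs ! s))" .
qed

text \<open>Kernel matrices are Gram matrices of features, so their quadratic forms are squared
  norms.\<close>

lemma gp_kernel:
  assumes "\<sigma> > 0"
  shows "gp_kernel X k \<sigma>"
proof
  show "k x y = k y x" if "x \<in> X" "y \<in> X" for x y
    using ip_sym[OF kernel_mem[OF that(1)] kernel_mem[OF that(2)]]
    by (simp only: ip_feature[OF that] ip_feature[OF that(2,1)])
  show "0 \<le> (\<Sum>r<length qs. \<Sum>s<length qs. w r * w s * k (qs ! r) (qs ! s))"
    if "set qs \<subseteq> X" for qs w
    unfolding ip_feature_sum(2)[OF that, of w, symmetric]
    by (rule ip_nonneg[OF ip_feature_sum(1)[OF that]])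
qed (fact assms)

text \<open>The left-hand side is the inner product of \<open>f\<close> with the difference of the feature of \<open>v\<close> and
  the weighted sum of the features of the points \<open>qs\<close>.\<close>

lemma interpolation_error_le:
  assumes f: "on_set X f \<in> H" "sqrt (ip (on_set X f) (on_set X f)) \<le> \<Psi>"
    and qs: "set qs \<subseteq> X" "v \<in> X" and gp: "gp_kernel X k \<sigma>"
  shows "\<bar>f v - (\<Sum>r<length qs. w r * f (qs ! r))\<bar> \<le> \<Psi> * sqrt (gp_kernel.feature_dist2 k qs w v)"
proof -
  interpret gp_kernel X k \<sigma> by (rule gp)
  let ?w = "case_nat (- 1) w" and ?q = "v # qs"
  define h where "h = (\<lambda>x. \<Sum>r<length ?q. ?w r * feature (?q ! r) x)"
  have q: "set ?q \<subseteq> X" using qs by simp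
  note h = ip_feature_sum[OF q, of ?w, folded h_def]
  have mem: "feature (?q ! r) \<in> H" if "r < length ?q" for r
    using q that nth_mem[OF that] by (intro kernel_mem) blast
  have "ip h (on_set X f) = (\<Sum>r<length ?q. ?w r * ip (feature (?q ! r)) (on_set X f))"
    unfolding h_def using mem f(1) by (rule ip_sum_left)
  also have "\<dots> = (\<Sum>r<length ?q. ?w r * f (?q ! r))"
  proof (intro sum.cong refl)
    fix r assume "r \<in> {..<length ?q}"
    then have r: "r < length ?q" by simp
    then have X: "?q ! r \<in> X" using q nth_mem[OF r] by blast
    have "ip (feature (?q ! r)) (on_set X f) = ip (on_set X f) (feature (?q ! r))"
      by (rule ip_sym[OF mem[OF r] f(1)])
    also have "\<dots> = f (?q ! r)" using reproducing[OF f(1) X] X by (simp add: on_set_def)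
    finally show "?w r * ip (feature (?q ! r)) (on_set X f) = ?w r * f (?q ! r)" by simp
  qed
  also have "\<dots> = - f v + (\<Sum>r<length qs. w r * f (qs ! r))"
    by (simp add: sum.lessThan_Suc_shift del: sum.lessThan_Suc)
  finally have "\<bar>f v - (\<Sum>r<length qs. w r * f (qs ! r))\<bar> = \<bar>ip h (on_set X f)\<bar>" by simp
  also have "\<dots> \<le> sqrt (ip h h) * sqrt (ip (on_set X f) (on_set X f))"
    by (rule Cauchy_Schwarz[OF h(1) f(1)])
  also have "\<dots> \<le> sqrt (ip h h) * \<Psi>"
    using f(2) ip_nonneg[OF h(1)] by (intro mult_left_mono) auto
  also have "ip h h = feature_dist2 qs w v"
    unfolding h(2) feature_dist2_eq[OF qs] ..
  finally show ?thesis by (simp add: mult.commute)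
qed

end

text \<open>The Hilbert space behind the norm bound is opened only here; later arguments see the
  bound only through these three consequences.\<close>

lemma rkhs_norm_leD:
  assumes "rkhs_norm_le X k f \<Psi>" "\<sigma> > 0"
  shows "gp_kernel X k \<sigma>" "\<Psi> \<ge> 0"
    and "\<And>qs v w. set qs \<subseteq> X \<Longrightarrow> v \<in> X \<Longrightarrow>
      \<bar>f v - (\<Sum>r<length qs. w r * f (qs ! r))\<bar> \<le> \<Psi> * sqrt (gp_kernel.feature_dist2 k qs w v)"
proof -
  obtain H ip where H: "rkhs X k H ip" and f: "on_set X f \<in> H"
    and norm: "sqrt (ip (on_set X f) (on_set X f)) \<le> \<Psi>"
    using assms(1) unfolding rkhs_norm_le_def by blast
  interpret rkhs X k H ip by (rule H)
  show gp: "gp_kernel X k \<sigma>" using assms(2) by (rule gp_kernel)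
  show "\<Psi> \<ge> 0" using norm ip_nonneg[OF f] real_sqrt_ge_zero order_trans by blast
  show "\<bar>f v - (\<Sum>r<length qs. w r * f (qs ! r))\<bar> \<le> \<Psi> * sqrt (gp_kernel.feature_dist2 k qs w v)"
    if "set qs \<subseteq> X" "v \<in> X" for qs v w
    using interpolation_error_le[OF f norm that gp] .
qed

section \<open>Robust minima and the elimination rule under a confidence band\<close>

lemma finite_perturb: "finite X \<Longrightarrow> finite (perturb X D \<xi> x)"
  by (rule finite_subset[of _ "(\<lambda>x'. x' - x) ` X"]) (auto simp: perturb_def)

lemma perturb_mem: "\<eta> \<in> perturb X D \<xi> x \<Longrightarrow> x + \<eta> \<in> X"
  by (auto simp: perturb_def)

text \<open>It suffices to evaluate \<open>g\<close> at the perturbation that minimises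
  \<open>h\<close>.\<close>

lemma robust_min_le_add:
  assumes "finite X" "perturb X D \<xi> x \<noteq> {}"
    and "\<And>\<eta>. \<eta> \<in> perturb X D \<xi> x \<Longrightarrow> g (x + \<eta>) \<le> h (x + \<eta>) + c"
  shows "robust_min X D \<xi> g x \<le> robust_min X D \<xi> h x + (c::real)"
proof -
  let ?P = "perturb X D \<xi> x"
  have fin: "finite ((\<lambda>\<eta>. g (x + \<eta>)) ` ?P)" "finite ((\<lambda>\<eta>. h (x + \<eta>)) ` ?P)"
    using finite_perturb[OF assms(1)] by auto
  have "Min ((\<lambda>\<eta>. h (x + \<eta>)) ` ?P) \<in> (\<lambda>\<eta>. h (x + \<eta>)) ` ?P"
    using fin assms(2) by (intro Min_in) auto
  then obtain \<eta> where \<eta>: "\<eta> \<in> ?P" "robust_min X D \<xi> h x = h (x + \<eta>)"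
    by (auto simp: robust_min_def)
  have "robust_min X D \<xi> g x \<le> g (x + \<eta>)"
    unfolding robust_min_def using fin \<eta> by (intro Min_le) auto
  also have "\<dots> \<le> h (x + \<eta>) + c" using assms(3) \<eta>(1) .
  finally show ?thesis using \<eta>(2) by simp
qed

text \<open>The optimum survives since for every \<open>w\<close> the robust minimum of
  \<open>lcb\<close> at \<open>w\<close> is at most that of \<open>f\<close> at \<open>w\<close>,
  then of \<open>f\<close> at \<open>xopt\<close>, then of \<open>ucb\<close> at
  \<open>xopt\<close>. For a survivor \<open>x\<close> the chain runs from \<open>f\<close> to
  \<open>lcb\<close> at \<open>xopt\<close>, through the maximum of \<open>lcb\<close> to
  \<open>ucb\<close> at \<open>x\<close>, and down to \<open>f\<close> at \<open>x\<close>. Its two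
  changes between \<open>f\<close> and a band edge cost \<open>2 * W\<close> each.\<close>

lemma robust_elimination:
  fixes S :: "'a::ab_group_add set" and f m s :: "'a \<Rightarrow> real"
  assumes X: "finite X" "S \<subseteq> X" "\<And>v. v \<in> X \<Longrightarrow> perturb X D \<xi> v \<noteq> {}"
    and conf: "\<And>v. v \<in> X \<Longrightarrow> \<bar>f v - m v\<bar> \<le> s v"
    and opt: "robust_optimal X D \<xi> f xopt" "xopt \<in> S"
  defines "ucb \<equiv> \<lambda>v. m v + s v" and "lcb \<equiv> \<lambda>v. m v - s v"
  shows "Max (robust_min X D \<xi> lcb ` S) \<le> robust_min X D \<xi> ucb xopt"
    and "\<And>x W. x \<in> S \<Longrightarrow> Max (robust_min X D \<xi> lcb ` S) \<le> robust_min X D \<xi> ucb x \<Longrightarrow>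
      (\<And>w \<eta>. w \<in> S \<Longrightarrow> \<eta> \<in> perturb X D \<xi> w \<Longrightarrow> s (w + \<eta>) \<le> W) \<Longrightarrow>
      robust_regret X D \<xi> f xopt x \<le> 4 * W"
proof -
  let ?r = "robust_min X D \<xi>"
  have S: "finite S" "S \<noteq> {}" using X opt(2) finite_subset by auto
  have le: "?r g w \<le> ?r h w + c"
    if "w \<in> S" "\<And>\<eta>. \<eta> \<in> perturb X D \<xi> w \<Longrightarrow> g (w + \<eta>) \<le> h (w + \<eta>) + c" for g h w and c :: real
    using X that by (intro robust_min_le_add) auto
  have mem: "w + \<eta> \<in> X" if "\<eta> \<in> perturb X D \<xi> w" for w \<eta>
    using that by (rule perturb_mem)
  have lcb_f: "?r lcb w \<le> ?r f w" and f_ucb: "?r f w \<le> ?r ucb w" if "w \<in> S" for w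
    using le[OF that, of lcb f 0] le[OF that, of f ucb 0] conf[OF mem[of _ w]]
    by (force simp: lcb_def ucb_def abs_le_iff)+
  show "Max (?r lcb ` S) \<le> ?r ucb xopt"
  proof (rule Max.boundedI)
    fix b assume "b \<in> ?r lcb ` S"
    then obtain w where w: "w \<in> S" "b = ?r lcb w" by blast
    have "?r f w \<le> ?r f xopt" using opt w X(2) by (auto simp: robust_optimal_def)
    then show "b \<le> ?r ucb xopt" using lcb_f[OF w(1)] f_ucb[OF opt(2)] w(2) by simp
  qed (use S in auto)
  show "robust_regret X D \<xi> f xopt x \<le> 4 * W"
    if x: "x \<in> S" and surv: "Max (?r lcb ` S) \<le> ?r ucb x"
      and W: "\<And>w \<eta>. w \<in> S \<Longrightarrow> \<eta> \<in> perturb X D \<xi> w \<Longrightarrow> s (w + \<eta>) \<le> W" for x W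
  proof -
    have "f (xopt + \<eta>) \<le> lcb (xopt + \<eta>) + 2 * W" if "\<eta> \<in> perturb X D \<xi> xopt" for \<eta>
      using conf[OF mem[OF that]] W[OF opt(2) that] by (simp add: lcb_def abs_le_iff)
    then have "?r f xopt \<le> ?r lcb xopt + 2 * W" by (rule le[OF opt(2)])
    moreover have "ucb (x + \<eta>) \<le> f (x + \<eta>) + 2 * W" if "\<eta> \<in> perturb X D \<xi> x" for \<eta>
      using conf[OF mem[OF that]] W[OF x that] by (simp add: ucb_def abs_le_iff)
    then have "?r ucb x \<le> ?r f x + 2 * W" by (rule le[OF x])
    moreover have "?r lcb xopt \<le> Max (?r lcb ` S)" using S opt(2) by (intro Max_ge) auto
    ultimately show ?thesis using surv by (simp add: robust_regret_def)
  qed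
qed

context gp_kernel
begin

lemma max_uncertainty_le:
  assumes fin: "finite X" and diag: "\<And>v. v \<in> X \<Longrightarrow> k v v = 1"
    and qs: "set qs \<subseteq> X" "qs \<noteq> []" and v: "v \<in> X"
    and greedy: "\<And>j. j < length qs \<Longrightarrow> post_sd k \<sigma> (take j qs) v \<le> post_sd k \<sigma> (take j qs) (qs ! j)"
  shows "post_sd k \<sigma> qs v
    \<le> sqrt (2 * (\<sigma>\<^sup>2 + 1) * max_info_gain k \<sigma> X (length qs) / real (length qs))"
proof -
  let ?n = "length qs"
  have sub: "set (take j qs) \<subseteq> X" for j using qs set_take_subset[of j qs] by blast
  have "real ?n * post_var qs v = (\<Sum>j<?n. post_var qs v)" by simp
  also have "\<dots> \<le> (\<Sum>j<?n. post_var (take j qs) (qs ! j))"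
  proof (rule sum_mono)
    fix j assume "j \<in> {..<?n}"
    then have j: "j < ?n" by simp
    then have qj: "qs ! j \<in> X" using qs by auto
    \<comment> \<open>Further queries only shrink the variance at \<open>v\<close>, so the final
      variance is comparable at every step \<open>j\<close>, where the greedy rule passes from
      \<open>v\<close> to the point actually queried.\<close>
    have "post_var qs v \<le> post_var (take j qs) v"
      using post_var_append[of "take j qs" "drop j qs" v] qs by simp
    also have "\<dots> = (post_sd k \<sigma> (take j qs) v)\<^sup>2" using post_sd_sq[OF sub v] by simp
    also have "\<dots> \<le> (post_sd k \<sigma> (take j qs) (qs ! j))\<^sup>2"
      using greedy[OF j] post_sd_nonneg[OF sub v] by (intro power_mono)
    also have "\<dots> = post_var (take j qs) (qs ! j)" by (rule post_sd_sq[OF sub qj])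
    finally show "post_var qs v \<le> post_var (take j qs) (qs ! j)" .
  qed
  also have "\<dots> \<le> 2 * (\<sigma>\<^sup>2 + 1) * info_gain k \<sigma> qs"
    using qs(1) diag by (rule sum_post_var_le_info_gain)
  also have "\<dots> \<le> 2 * (\<sigma>\<^sup>2 + 1) * max_info_gain k \<sigma> X ?n"
    using max_info_gain_ge[OF fin qs(1)] by (intro mult_left_mono) auto
  finally show ?thesis
    using qs unfolding post_sd_eq[OF qs(1)] by (intro real_sqrt_le_mono) (simp add: field_simps)
qed

end


subsection \<open>One execution of the algorithm\<close>

text \<open>Named copy of the list \<open>q\<close> bound inside \<open>robust_bpe\<close>. Steps
  count from 1 and list entries from 0, so entry \<open>r\<close> belongs to step
  \<open>Suc r\<close>.\<close>

definition batch_queries ::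
  "real \<Rightarrow> nat \<Rightarrow> (nat \<Rightarrow> 'a::plus) \<Rightarrow> (nat \<Rightarrow> 'a) \<Rightarrow> nat \<Rightarrow> nat \<Rightarrow> 'a list" where
  "batch_queries a T x u i j =
     map (\<lambda>j'. x (batch_start a T i + j') + u (batch_start a T i + j')) [1..<Suc j]"

definition batch_obs :: "real \<Rightarrow> nat \<Rightarrow> (nat \<Rightarrow> real) \<Rightarrow> nat \<Rightarrow> real list" where
  "batch_obs a T y i = map (\<lambda>j'. y (batch_start a T i + j')) [1..<Suc (batch_size a T i)]"

lemma length_batch_queries [simp]: "length (batch_queries a T x u i j) = j"
  by (simp add: batch_queries_def del: upt_Suc)

lemma length_batch_obs [simp]: "length (batch_obs a T y i) = batch_size a T i"
  by (simp add: batch_obs_def del: upt_Suc)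

lemma nth_batch_queries:
  "r < j \<Longrightarrow> batch_queries a T x u i j ! r = x (batch_start a T i + Suc r) + u (batch_start a T i + Suc r)"
  by (simp add: batch_queries_def del: upt_Suc)

lemma nth_batch_obs:
  "r < batch_size a T i \<Longrightarrow> batch_obs a T y i ! r = y (batch_start a T i + Suc r)"
  by (simp add: batch_obs_def del: upt_Suc)

lemma take_batch_queries: "r \<le> j \<Longrightarrow> take r (batch_queries a T x u i j) = batch_queries a T x u i r"
  by (simp add: batch_queries_def take_map del: upt_Suc)

lemma robust_bpeE:
  assumes "robust_bpe X k D \<xi> \<Psi> \<sigma> a T \<delta> x u y"
  defines "c \<equiv> sqrt (bpe_beta \<Psi> (card X) (num_batches a T) \<delta>)"
    and "q \<equiv> \<lambda>i. batch_queries a T x u i (batch_size a T i)"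
  obtains S where "S 1 = X"
    and "\<And>i j. i \<in> {1..num_batches a T} \<Longrightarrow> j \<in> {1..batch_size a T i} \<Longrightarrow> x (batch_start a T i + j) \<in> S i"
    and "\<And>i j. i \<in> {1..num_batches a T} \<Longrightarrow> j \<in> {1..batch_size a T i} \<Longrightarrow>
      u (batch_start a T i + j) \<in> perturb X D \<xi> (x (batch_start a T i + j))"
    and "\<And>i j w \<eta>. i \<in> {1..num_batches a T} \<Longrightarrow> j \<in> {1..batch_size a T i} \<Longrightarrow> w \<in> S i \<Longrightarrow>
      \<eta> \<in> perturb X D \<xi> w \<Longrightarrow> post_sd k \<sigma> (batch_queries a T x u i (j - 1)) (w + \<eta>)
      \<le> post_sd k \<sigma> (batch_queries a T x u i (j - 1)) (x (batch_start a T i + j) + u (batch_start a T i + j))"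
    and "\<And>i. i \<in> {1..num_batches a T} \<Longrightarrow> S (Suc i) = {w \<in> S i.
      Max (robust_min X D \<xi> (\<lambda>v. post_mean k \<sigma> (q i) (batch_obs a T y i) v - c * post_sd k \<sigma> (q i) v) ` S i)
      \<le> robust_min X D \<xi> (\<lambda>v. post_mean k \<sigma> (q i) (batch_obs a T y i) v + c * post_sd k \<sigma> (q i) v) w}"
proof -
  obtain S where S: "S 1 = X" "\<forall>i\<in>{1..num_batches a T}.
      (\<forall>j\<in>{1..batch_size a T i}. x (batch_start a T i + j) \<in> S i \<and>
         u (batch_start a T i + j) \<in> perturb X D \<xi> (x (batch_start a T i + j)) \<and>
         (\<forall>v \<in> (\<Union>w\<in>S i. {w + \<eta> | \<eta>. \<eta> \<in> perturb X D \<xi> w}).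
            post_sd k \<sigma> (batch_queries a T x u i (j - 1)) v
            \<le> post_sd k \<sigma> (batch_queries a T x u i (j - 1)) (x (batch_start a T i + j) + u (batch_start a T i + j)))) \<and>
      S (Suc i) = {w \<in> S i.
        Max (robust_min X D \<xi> (\<lambda>v. post_mean k \<sigma> (q i) (batch_obs a T y i) v - c * post_sd k \<sigma> (q i) v) ` S i)
        \<le> robust_min X D \<xi> (\<lambda>v. post_mean k \<sigma> (q i) (batch_obs a T y i) v + c * post_sd k \<sigma> (q i) v) w}"
    using assms(1) unfolding robust_bpe_def Let_def q_def c_def batch_queries_def batch_obs_def by blast
  show ?thesis
  proof (rule that[of S])
    fix i j w \<eta> assume "i \<in> {1..num_batches a T}" "j \<in> {1..batch_size a T i}" "w \<in> S i"
      "\<eta> \<in> perturb X D \<xi> w"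
    moreover from this have "w + \<eta> \<in> (\<Union>w\<in>S i. {w + \<eta> | \<eta>. \<eta> \<in> perturb X D \<xi> w})" by blast
    ultimately show "post_sd k \<sigma> (batch_queries a T x u i (j - 1)) (w + \<eta>)
      \<le> post_sd k \<sigma> (batch_queries a T x u i (j - 1)) (x (batch_start a T i + j) + u (batch_start a T i + j))"
      using S(2) by blast
  qed (use S in blast)+
qed

text \<open>The deterministic part of the argument. Batch 1 runs before any elimination and gets the
  trivial bound \<open>2 * \<Psi>\<close> per step; points of batch \<open>Suc i\<close> have
  survived batch \<open>i\<close> and are charged to the width reached there.\<close>

lemma robust_bpe_cum_regret_le:
  fixes X :: "'a::ab_group_add set"
  assumes X: "finite X" "\<And>v. v \<in> X \<Longrightarrow> perturb X D \<xi> v \<noteq> {}"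
    and gp: "gp_kernel X k \<sigma>" and diag: "\<And>v. v \<in> X \<Longrightarrow> k v v = 1"
    and a: "0 < a" "a < 1" and T: "T \<ge> 1"
    and alg: "robust_bpe X k D \<xi> \<Psi> \<sigma> a T \<delta> x u y"
    and opt: "robust_optimal X D \<xi> f xopt"
    and bounded: "\<And>v. v \<in> X \<Longrightarrow> \<bar>f v\<bar> \<le> \<Psi>"
  defines "c \<equiv> sqrt (bpe_beta \<Psi> (card X) (num_batches a T) \<delta>)"
    and "q \<equiv> \<lambda>i. batch_queries a T x u i (batch_size a T i)"
  assumes conf: "\<And>i v. i \<in> {1..num_batches a T} \<Longrightarrow> v \<in> X \<Longrightarrow>
      \<bar>f v - post_mean k \<sigma> (q i) (batch_obs a T y i) v\<bar> \<le> c * post_sd k \<sigma> (q i) v"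
  shows "cum_regret X D \<xi> f xopt T x \<le> 2 * \<Psi> * real (batch_size a T 1)
    + (\<Sum>i\<in>{1..<num_batches a T}. real (batch_size a T (Suc i)) * (4 * (c *
        sqrt (2 * (\<sigma>\<^sup>2 + 1) * max_info_gain k \<sigma> X (batch_size a T i) / real (batch_size a T i)))))"
proof -
  interpret gp_kernel X k \<sigma> by (rule gp)
  let ?B = "num_batches a T" and ?N = "batch_size a T" and ?s = "batch_start a T"
  let ?r = "robust_regret X D \<xi> f xopt"
  define W where "W i = sqrt (2 * (\<sigma>\<^sup>2 + 1) * max_info_gain k \<sigma> X (?N i) / real (?N i))" for i
  obtain S where S1: "S 1 = X"
    and x_mem: "\<And>i j. i \<in> {1..?B} \<Longrightarrow> j \<in> {1..?N i} \<Longrightarrow> x (?s i + j) \<in> S i"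
    and u_mem: "\<And>i j. i \<in> {1..?B} \<Longrightarrow> j \<in> {1..?N i} \<Longrightarrow> u (?s i + j) \<in> perturb X D \<xi> (x (?s i + j))"
    and greedy: "\<And>i j w \<eta>. i \<in> {1..?B} \<Longrightarrow> j \<in> {1..?N i} \<Longrightarrow> w \<in> S i \<Longrightarrow> \<eta> \<in> perturb X D \<xi> w \<Longrightarrow>
      post_sd k \<sigma> (batch_queries a T x u i (j - 1)) (w + \<eta>)
      \<le> post_sd k \<sigma> (batch_queries a T x u i (j - 1)) (x (?s i + j) + u (?s i + j))"
    and S_Suc: "\<And>i. i \<in> {1..?B} \<Longrightarrow> S (Suc i) = {w \<in> S i.
      Max (robust_min X D \<xi> (\<lambda>v. post_mean k \<sigma> (q i) (batch_obs a T y i) v - c * post_sd k \<sigma> (q i) v) ` S i)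
      \<le> robust_min X D \<xi> (\<lambda>v. post_mean k \<sigma> (q i) (batch_obs a T y i) v + c * post_sd k \<sigma> (q i) v) w}"
    by (rule robust_bpeE[OF alg]) (rule that[unfolded c_def q_def]; assumption)
  have c: "c \<ge> 0" by (simp add: c_def bpe_beta_def)
  have active: "S (Suc i) \<subseteq> X \<and> xopt \<in> S (Suc i)" if "i \<le> ?B" for i
    using that
  proof (induction i)
    case 0
    then show ?case using S1 opt by (simp add: robust_optimal_def)
  next
    case (Suc i)
    then have IH: "S (Suc i) \<subseteq> X" "xopt \<in> S (Suc i)" and i: "Suc i \<in> {1..?B}" by auto
    show ?case
      using robust_elimination(1)[OF X(1) IH(1) X(2) conf[OF i] opt IH(2)] IH
      unfolding S_Suc[OF i] by blast
  qed
  have qX: "set (q i) \<subseteq> X" if i: "i \<in> {1..?B}" for i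
  proof
    fix v assume "v \<in> set (q i)"
    then obtain r where "r < ?N i" "v = q i ! r" by (auto simp: q_def in_set_conv_nth)
    then show "v \<in> X"
      using perturb_mem[OF u_mem[OF i, of "Suc r"]] by (simp add: q_def nth_batch_queries)
  qed
  have width: "post_sd k \<sigma> (q i) (w + \<eta>) \<le> W i"
    if i: "i \<in> {1..<?B}" and w: "w \<in> S i" "\<eta> \<in> perturb X D \<xi> w" for i w \<eta>
  proof -
    have iB: "i \<in> {1..?B}" using i by simp
    have len: "length (q i) = ?N i" by (simp add: q_def)
    have ne: "q i \<noteq> []"
      using batch_size_inner_ge_1[OF a T, of i] i len by (metis atLeastLessThan_iff list.size(3) not_one_le_zero)
    have v: "w + \<eta> \<in> X" using w(2) by (rule perturb_mem)
    have "post_sd k \<sigma> (take j (q i)) (w + \<eta>) \<le> post_sd k \<sigma> (take j (q i)) (q i ! j)"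
      if "j < length (q i)" for j
      using greedy[OF iB _ w, of "Suc j"] that by (simp add: q_def take_batch_queries nth_batch_queries)
    from max_uncertainty_le[OF X(1) diag qX[OF iB] ne v this]
    show ?thesis by (simp add: W_def len)
  qed
  have late: "?r (x (?s (Suc i) + j)) \<le> 4 * (c * W i)"
    if i: "i \<in> {1..<?B}" and j: "j \<in> {1..?N (Suc i)}" for i j
  proof -
    have iB: "i \<in> {1..?B}" "Suc i \<in> {1..?B}" using i by auto
    have "i - 1 \<le> ?B" "Suc (i - 1) = i" using i by auto
    then have act: "S i \<subseteq> X" "xopt \<in> S i" using active[of "i - 1"] by auto
    have "x (?s (Suc i) + j) \<in> S (Suc i)" using x_mem[OF iB(2) j] .
    then show ?thesis
      unfolding S_Suc[OF iB(1)]
      using robust_elimination(2)[OF X(1) act(1) X(2) conf[OF iB(1)] opt act(2), of "x (?s (Suc i) + j)" "c * W i"]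
        mult_left_mono[OF width[OF i] c] by blast
  qed
  have first: "?r (x (?s 1 + j)) \<le> 2 * \<Psi>" if j: "j \<in> {1..?N 1}" for j
  proof -
    have "1 \<in> {1..?B}" using num_batches_ge_1[OF a T] by simp
    then have xX: "x (?s 1 + j) \<in> X" using x_mem[of 1 j] j S1 by simp
    \<comment> \<open>Comparison with the zero function turns
      \<open>\<bar>f v\<bar> \<le> \<Psi>\<close> into the same bound for robust minima.\<close>
    have zero: "robust_min X D \<xi> (\<lambda>_. 0) w = (0::real)" if "w \<in> X" for w
      using X(2)[OF that] by (simp add: robust_min_def image_constant_conv)
    have oX: "xopt \<in> X" using opt by (simp add: robust_optimal_def)
    have "robust_min X D \<xi> f xopt \<le> robust_min X D \<xi> (\<lambda>_. 0) xopt + \<Psi>"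
      using bounded[OF perturb_mem] by (intro robust_min_le_add X X(2) oX) (simp add: abs_le_iff)
    moreover have "robust_min X D \<xi> (\<lambda>_. 0) (x (?s 1 + j)) \<le> robust_min X D \<xi> f (x (?s 1 + j)) + \<Psi>"
      using bounded[OF perturb_mem] by (intro robust_min_le_add X X(2) xX) (force simp: abs_le_iff)
    ultimately show ?thesis using zero[OF oX] zero[OF xX] by (simp add: robust_regret_def)
  qed
  have "cum_regret X D \<xi> f xopt T x = (\<Sum>i=1..?B. \<Sum>j=1..?N i. ?r (x (?s i + j)))"
    unfolding cum_regret_def
    using sum_upto_batch_start[of "\<lambda>t. ?r (x t)" a T ?B] batch_start_num_batches[OF a T] by simp
  also have "{1..?B} = insert 1 (Suc ` {1..<?B})"
    using num_batches_ge_1[OF a T] by (auto simp: image_Suc_atLeastLessThan)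
  also have "(\<Sum>i\<in>insert 1 (Suc ` {1..<?B}). \<Sum>j=1..?N i. ?r (x (?s i + j)))
      = (\<Sum>j=1..?N 1. ?r (x (?s 1 + j))) + (\<Sum>i\<in>{1..<?B}. \<Sum>j=1..?N (Suc i). ?r (x (?s (Suc i) + j)))"
    using sum.reindex[OF inj_Suc, of "\<lambda>i. \<Sum>j=1..?N i. ?r (x (?s i + j))" "{1..<?B}"]
    by (subst sum.insert) (auto simp del: image_Suc_atLeastLessThan)
  also have "\<dots> \<le> (\<Sum>j=1..?N 1. 2 * \<Psi>) + (\<Sum>i\<in>{1..<?B}. \<Sum>j=1..?N (Suc i). 4 * (c * W i))"
    using first late by (intro add_mono sum_mono) auto
  finally show ?thesis by (simp add: W_def mult.commute)
qed


subsection \<open>Confidence bounds\<close>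

sublocale robust_bpe_run \<subseteq> noise: adapted_noise M F z \<sigma> T
  by unfold_locales (use sub_F mono_F noise_normal noise_adapted noise_indep in blast)+

context robust_bpe_run
begin

abbreviation queries :: "nat \<Rightarrow> 'w \<Rightarrow> (real ^ 'd) list" where
  "queries i \<omega> \<equiv> batch_queries a T (\<lambda>t. x t \<omega>) (\<lambda>t. u t \<omega>) i (batch_size a T i)"

abbreviation observations :: "nat \<Rightarrow> 'w \<Rightarrow> real list" where
  "observations i \<omega> \<equiv> batch_obs a T (\<lambda>t. f (x t \<omega> + u t \<omega>) + z t \<omega>) i"

text \<open>All choices of a batch are measurable at its start, so fixing the whole query list is an
  event of the past relative to the noise of that batch.\<close>

lemma queries_event:
  assumes i: "i \<in> {1..num_batches a T}" and q: "length q = batch_size a T i"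
  shows "{\<omega> \<in> space M. queries i \<omega> = q} \<in> sets (F (batch_start a T i))"
proof -
  let ?F = "F (batch_start a T i)"
  let ?p = "\<lambda>r \<omega>. x (batch_start a T i + Suc r) \<omega> + u (batch_start a T i + Suc r) \<omega>"
  have "{\<omega> \<in> space M. queries i \<omega> = q} = {\<omega> \<in> space ?F. \<forall>r\<in>{..<batch_size a T i}. ?p r \<omega> = q ! r}"
    using q by (auto simp: noise.space_F list_eq_iff_nth_eq nth_batch_queries)
  also have "\<dots> \<in> sets ?F"
  proof (rule sets.sets_Collect_finite_All)
    fix r assume "r \<in> {..<batch_size a T i}"
    then have r: "Suc r \<in> {1..batch_size a T i}" by auto
    have "?p r \<in> borel_measurable ?F"
      using choice_measurable[OF i r] by (intro borel_measurable_add) auto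
    from measurable_sets[OF this, of "{q ! r}"]
    have "?p r -` {q ! r} \<inter> space ?F \<in> sets ?F" by simp
    also have "?p r -` {q ! r} \<inter> space ?F = {\<omega> \<in> space ?F. ?p r \<omega> = q ! r}" by auto
    finally show "{\<omega> \<in> space ?F. ?p r \<omega> = q ! r} \<in> sets ?F" .
  qed simp
  finally show ?thesis .
qed

lemma x_measurable:
  assumes "t \<in> {1..T}" "0 < a" "a < 1"
  shows "x t \<in> borel_measurable M"
proof -
  have "T \<ge> 1" using assms(1) by simp
  then obtain i j where "i \<in> {1..num_batches a T}" "j \<in> {1..batch_size a T i}" "t = batch_start a T i + j"
    using ex_batch_of_time[OF assms(2,3) _ assms(1)] by blast
  then have "x t \<in> borel_measurable (F (batch_start a T i))" using choice_measurable by blast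
  then show ?thesis by (rule measurable_from_subalg[OF sub_F])
qed

lemma x_u_mem:
  assumes "\<omega> \<in> space M" "i \<in> {1..num_batches a T}" "j \<in> {1..batch_size a T i}"
  shows "x (batch_start a T i + j) \<omega> \<in> X"
    and "x (batch_start a T i + j) \<omega> + u (batch_start a T i + j) \<omega> \<in> X"
proof -
  let ?B = "num_batches a T"
  obtain S where S: "S 1 = X" "\<And>i j. i \<in> {1..?B} \<Longrightarrow> j \<in> {1..batch_size a T i} \<Longrightarrow> x (batch_start a T i + j) \<omega> \<in> S i"
    "\<And>i j. i \<in> {1..?B} \<Longrightarrow> j \<in> {1..batch_size a T i} \<Longrightarrow>
      u (batch_start a T i + j) \<omega> \<in> perturb X D \<xi> (x (batch_start a T i + j) \<omega>)"
    "\<And>i. i \<in> {1..?B} \<Longrightarrow> S (Suc i) \<subseteq> S i"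
    by (rule robust_bpeE[OF algorithm[OF assms(1)]]) (rule that, assumption+, blast)
  have "S i \<subseteq> X" if "i \<in> {1..?B}" for i
    using that
  proof (induction i)
    case (Suc i)
    then show ?case using S(1) S(4)[of i] by (cases "i = 0") auto
  qed simp
  then show "x (batch_start a T i + j) \<omega> \<in> X" using S(2) assms by blast
  show "x (batch_start a T i + j) \<omega> + u (batch_start a T i + j) \<omega> \<in> X"
    using S(3)[OF assms(2,3)] by (rule perturb_mem)
qed

lemma queries_subset:
  assumes "\<omega> \<in> space M" "i \<in> {1..num_batches a T}"
  shows "set (queries i \<omega>) \<subseteq> X"
proof
  fix v assume "v \<in> set (queries i \<omega>)"
  then obtain r where "r < batch_size a T i" "v = queries i \<omega> ! r" by (auto simp: in_set_conv_nth)
  then show "v \<in> X" using x_u_mem(2)[OF assms, of "Suc r"] by (simp add: nth_batch_queries)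
qed

lemma x_mem:
  assumes "\<omega> \<in> space M" "t \<in> {1..T}" "0 < a" "a < 1"
  shows "x t \<omega> \<in> X"
proof -
  have "T \<ge> 1" using assms(2) by simp
  then show ?thesis
    using ex_batch_of_time[OF assms(3,4) _ assms(2)] x_u_mem(1)[OF assms(1)] by metis
qed

text \<open>Each \<open>x t\<close> takes finitely many values and is therefore a simple function;
  composing it with any function, here the regret, keeps it simple.\<close>

lemma cum_regret_measurable:
  assumes a: "0 < a" "a < 1"
  shows "(\<lambda>\<omega>. cum_regret X D \<xi> f xopt T (\<lambda>t. x t \<omega>)) \<in> borel_measurable M"
  unfolding cum_regret_def
proof (rule borel_measurable_sum)
  fix t assume t: "t \<in> {1..T}"
  have "x t ` space M \<subseteq> X" using x_mem[OF _ t a] by auto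
  then have "finite (x t ` space M)" using finite_X by (rule finite_subset)
  then have "simple_function M (x t)"
    by (rule simple_function_borel_measurable[OF x_measurable[OF t a]])
  then have "simple_function M (\<lambda>\<omega>. robust_regret X D \<xi> f xopt (x t \<omega>))"
    by (rule simple_function_compose1)
  then show "(\<lambda>\<omega>. robust_regret X D \<xi> f xopt (x t \<omega>)) \<in> borel_measurable M"
    by (rule borel_measurable_simple_function)
qed

text \<open>Restricting to a fixed list \<open>q\<close> turns the weights into constants; the
  second set says that the noise part of the posterior mean at \<open>v\<close> is too
  large.\<close>

definition miss_event :: "real \<Rightarrow> nat \<Rightarrow> real ^ 'd \<Rightarrow> (real ^ 'd) list \<Rightarrow> 'w set" where
  "miss_event c i v q = {\<omega> \<in> space M. queries i \<omega> = q} \<inter> {\<omega> \<in> space M.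
     \<bar>\<Sum>r<batch_size a T i. gp_kernel.gp_weights k \<sigma> q v r * z (batch_start a T i + Suc r) \<omega>\<bar>
       > c * post_sd k \<sigma> q v}"

lemma batch_end_le: "i \<in> {1..num_batches a T} \<Longrightarrow> batch_start a T i + batch_size a T i \<le> T"
  using batch_start_le[of a T "Suc i"] batch_start_Suc[of i a T] by simp

lemma miss_event_event:
  assumes "i \<in> {1..num_batches a T}" "length q = batch_size a T i"
  shows "miss_event c i v q \<in> events"
proof -
  have "(\<lambda>\<omega>. \<Sum>r<batch_size a T i. gp_kernel.gp_weights k \<sigma> q v r * z (batch_start a T i + Suc r) \<omega>)
      \<in> borel_measurable M"
    using batch_end_le[OF assms(1)]
    by (intro borel_measurable_sum borel_measurable_times noise.noise_measurable) auto
  then have "{\<omega> \<in> space M. \<bar>\<Sum>r<batch_size a T i. gp_kernel.gp_weights k \<sigma> q v r * z (batch_start a T i + Suc r) \<omega>\<bar>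
       > c * post_sd k \<sigma> q v} \<in> events"
    by measurable
  then show ?thesis
    unfolding miss_event_def using noise.sets_F[OF queries_event[OF assms]] by (rule sets.Int[rotated])
qed

text \<open>The events \<open>queries i \<omega> = q\<close> are disjoint, so the conditional tail
  bounds are weighted by probabilities of total at most 1. Summing over all lists thus costs
  nothing.\<close>

lemma sum_prob_miss_event_le:
  assumes \<sigma>: "\<sigma> > 0" and i: "i \<in> {1..num_batches a T}" and v: "v \<in> X" and c: "c \<ge> 0"
  defines "Q \<equiv> {q. set q \<subseteq> X \<and> length q = batch_size a T i}"
  shows "(\<Sum>q\<in>Q. prob (miss_event c i v q)) \<le> exp (- c\<^sup>2 / 2)"
proof -
  interpret K: gp_kernel X k \<sigma> by (rule rkhs_norm_leD(1)[OF rkhs_f \<sigma>])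
  let ?E = "\<lambda>q. {\<omega> \<in> space M. queries i \<omega> = q}"
  have fin: "finite Q" unfolding Q_def using finite_X by (rule finite_lists_length_eq)
  have E: "?E q \<in> events" if "q \<in> Q" for q
    using that queries_event[OF i, of q] by (auto simp: Q_def intro: noise.sets_F)
  have "(\<Sum>q\<in>Q. prob (miss_event c i v q)) \<le> (\<Sum>q\<in>Q. prob (?E q) * exp (- c\<^sup>2 / 2))"
  proof (rule sum_mono)
    fix q assume "q \<in> Q"
    then have q: "set q \<subseteq> X" and len: "length q = batch_size a T i" by (auto simp: Q_def)
    \<comment> \<open>Discarding the feature distance from the posterior variance leaves the
      variance of the noise part.\<close>
    have "\<sigma>\<^sup>2 * (\<Sum>j<batch_size a T i. (K.gp_weights q v j)\<^sup>2) \<le> (post_sd k \<sigma> q v)\<^sup>2"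
      using K.feature_dist2_nonneg[OF q v, of "K.gp_weights q v"]
      unfolding K.post_sd_sq[OF q v] K.post_var_gp_weights[OF q] by (simp add: len)
    then show "prob (miss_event c i v q) \<le> prob (?E q) * exp (- c\<^sup>2 / 2)"
      unfolding miss_event_def
      by (rule noise.noise_combination_tails_le[OF queries_event[OF i len] batch_end_le[OF i] \<sigma> c
            K.post_sd_nonneg[OF q v]])
  qed
  also have "\<dots> = (\<Sum>q\<in>Q. prob (?E q)) * exp (- c\<^sup>2 / 2)" by (simp add: sum_distrib_right)
  also have "(\<Sum>q\<in>Q. prob (?E q)) = prob (\<Union>q\<in>Q. ?E q)"
    using fin E by (intro finite_measure_finite_Union[symmetric]) (auto simp: disjoint_family_on_def)
  also have "\<dots> * exp (- c\<^sup>2 / 2) \<le> 1 * exp (- c\<^sup>2 / 2)" by (intro mult_right_mono) auto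
  finally show ?thesis by simp
qed

text \<open>The posterior mean is an interpolation of \<open>f\<close> plus a noise part. The former
  errs by at most \<open>\<Psi>\<close> standard deviations, the latter by at most \<open>c\<close>
  off the miss event.\<close>

lemma confidence:
  assumes \<sigma>: "\<sigma> > 0" and \<omega>: "\<omega> \<in> space M" and i: "i \<in> {1..num_batches a T}" and v: "v \<in> X"
    and miss: "\<omega> \<notin> miss_event c i v (queries i \<omega>)"
  shows "\<bar>f v - post_mean k \<sigma> (queries i \<omega>) (observations i \<omega>) v\<bar>
    \<le> (\<Psi> + c) * post_sd k \<sigma> (queries i \<omega>) v"
proof -
  interpret K: gp_kernel X k \<sigma> by (rule rkhs_norm_leD(1)[OF rkhs_f \<sigma>])
  define q where "q = queries i \<omega>"
  let ?N = "batch_size a T i" and ?s = "batch_start a T i"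
  let ?w = "K.gp_weights q v"
  have q: "set q \<subseteq> X" and len: "length q = ?N"
    using queries_subset[OF \<omega> i] by (auto simp: q_def)
  have "post_mean k \<sigma> q (observations i \<omega>) v = (\<Sum>r<?N. ?w r * (f (q ! r) + z (?s + Suc r) \<omega>))"
    by (subst K.post_mean_eq[OF q]) (auto simp: q_def nth_batch_obs nth_batch_queries)
  also have "\<dots> = (\<Sum>r<?N. ?w r * f (q ! r)) + (\<Sum>r<?N. ?w r * z (?s + Suc r) \<omega>)"
    by (simp add: distrib_left sum.distrib)
  finally have mean: "post_mean k \<sigma> q (observations i \<omega>) v
    = (\<Sum>r<?N. ?w r * f (q ! r)) + (\<Sum>r<?N. ?w r * z (?s + Suc r) \<omega>)" .
  have "\<bar>f v - (\<Sum>r<length q. ?w r * f (q ! r))\<bar> \<le> \<Psi> * sqrt (K.feature_dist2 q ?w v)"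
    using rkhs_norm_leD(3)[OF rkhs_f \<sigma> q v] .
  also have "\<dots> \<le> \<Psi> * post_sd k \<sigma> q v"
    unfolding K.post_sd_eq[OF q] K.post_var_gp_weights[OF q]
    using rkhs_norm_leD(2)[OF rkhs_f \<sigma>] by (intro mult_left_mono real_sqrt_le_mono) (auto intro!: mult_nonneg_nonneg sum_nonneg)
  finally have bias: "\<bar>f v - (\<Sum>r<?N. ?w r * f (q ! r))\<bar> \<le> \<Psi> * post_sd k \<sigma> q v" by (simp add: len)
  have "\<bar>\<Sum>r<?N. ?w r * z (?s + Suc r) \<omega>\<bar> \<le> c * post_sd k \<sigma> q v"
    using miss \<omega> by (simp add: miss_event_def q_def)
  then show ?thesis using bias mean unfolding q_def[symmetric] by (simp add: distrib_right abs_le_iff)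
qed

text \<open>The choice of \<open>\<beta>\<close> gives each pair of a batch and a point failure
  probability \<open>\<delta> / (card X * B)\<close>, so the union over all pairs fails with
  probability at most \<open>\<delta>\<close>. Off it the deterministic bound applies.\<close>

lemma cum_regret_whp:
  assumes \<sigma>: "\<sigma> > 0" and a: "0 < a" "a < 1" and T: "T \<ge> 1" and \<delta>: "0 < \<delta>" "\<delta> < 1"
    and diag: "\<And>v. v \<in> X \<Longrightarrow> k v v = 1" and opt: "robust_optimal X D \<xi> f xopt"
    and R: "2 * \<Psi> * real (batch_size a T 1) + (\<Sum>i\<in>{1..<num_batches a T}. real (batch_size a T (Suc i)) *
        (4 * (sqrt (bpe_beta \<Psi> (card X) (num_batches a T) \<delta>) *
        sqrt (2 * (\<sigma>\<^sup>2 + 1) * max_info_gain k \<sigma> X (batch_size a T i) / real (batch_size a T i))))) \<le> R"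
  shows "prob {\<omega> \<in> space M. cum_regret X D \<xi> f xopt T (\<lambda>t. x t \<omega>) \<le> R} \<ge> 1 - \<delta>"
proof -
  let ?B = "num_batches a T"
  let ?n = "real (card X) * real ?B"
  define c where "c = sqrt (2 * ln (?n / \<delta>))"
  have gp: "gp_kernel X k \<sigma>" and \<Psi>: "\<Psi> \<ge> 0" using rkhs_norm_leD[OF rkhs_f \<sigma>] by auto
  have "card X \<ge> 1" using finite_X nonempty_X by (simp add: Suc_leI card_gt_0_iff)
  then have n: "?n \<ge> 1" using num_batches_ge_1[OF a T] mult_mono[of 1 "real (card X)" 1 "real ?B"] by simp
  then have "?n / \<delta> \<ge> 1" using \<delta> by simp
  then have ln: "ln (?n / \<delta>) \<ge> 0" by simp
  have c: "c \<ge> 0" by (simp add: c_def ln)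
  have "- c\<^sup>2 / 2 = - ln (?n / \<delta>)" using ln by (simp add: c_def)
  also have "\<dots> = ln (\<delta> / ?n)" using n \<delta> by (simp add: ln_div)
  finally have expc: "exp (- c\<^sup>2 / 2) = \<delta> / ?n" using n \<delta> by simp
  have beta: "sqrt (bpe_beta \<Psi> (card X) ?B \<delta>) = \<Psi> + c"
    unfolding bpe_beta_def c_def[symmetric] using \<Psi> c by simp
  let ?Q = "\<lambda>i. {q. set q \<subseteq> X \<and> length q = batch_size a T i}"
  have finQ: "finite (?Q i)" for i using finite_X by (rule finite_lists_length_eq)
  let ?bad = "\<Union>i\<in>{1..?B}. \<Union>v\<in>X. \<Union>q\<in>?Q i. miss_event c i v q"
  have ev: "miss_event c i v q \<in> events" if "i \<in> {1..?B}" "q \<in> ?Q i" for i v q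
    using that by (intro miss_event_event) auto
  have evQ: "(\<Union>q\<in>?Q i. miss_event c i v q) \<in> events" if "i \<in> {1..?B}" for i v
    using that finQ ev by (intro sets.finite_UN) auto
  have evX: "(\<Union>v\<in>X. \<Union>q\<in>?Q i. miss_event c i v q) \<in> events" if "i \<in> {1..?B}" for i
    using finite_X evQ[OF that] by (rule sets.finite_UN)
  have bad: "?bad \<in> events" using finite_atLeastAtMost evX by (rule sets.finite_UN)
  have "prob ?bad \<le> (\<Sum>i\<in>{1..?B}. prob (\<Union>v\<in>X. \<Union>q\<in>?Q i. miss_event c i v q))"
    using evX by (intro finite_measure_subadditive_finite) auto
  also have "\<dots> \<le> (\<Sum>i\<in>{1..?B}. \<Sum>v\<in>X. prob (\<Union>q\<in>?Q i. miss_event c i v q))"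
    using evQ finite_X by (intro sum_mono finite_measure_subadditive_finite) auto
  also have "\<dots> \<le> (\<Sum>i\<in>{1..?B}. \<Sum>v\<in>X. \<Sum>q\<in>?Q i. prob (miss_event c i v q))"
    using ev finQ by (intro sum_mono finite_measure_subadditive_finite) auto
  also have "\<dots> \<le> (\<Sum>i\<in>{1..?B}. \<Sum>v\<in>X. \<delta> / ?n)"
    using sum_prob_miss_event_le[OF \<sigma> _ _ c] unfolding expc by (intro sum_mono)
  also have "\<dots> = ?n * (\<delta> / ?n)" by simp
  also have "\<dots> = \<delta>" using n by (metis nonzero_mult_div_cancel_left not_one_le_zero times_divide_eq_right)
  finally have prob_bad: "prob ?bad \<le> \<delta>" .
  have "space M - ?bad \<subseteq> {\<omega> \<in> space M. cum_regret X D \<xi> f xopt T (\<lambda>t. x t \<omega>) \<le> R}"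
  proof
    fix \<omega> assume \<omega>: "\<omega> \<in> space M - ?bad"
    then have sp: "\<omega> \<in> space M" by simp
    \<comment> \<open>Interpolation from the empty list of points, whose feature distance is
      \<open>k v v = 1\<close>.\<close>
    have bounded: "\<bar>f v\<bar> \<le> \<Psi>" if "v \<in> X" for v
      using rkhs_norm_leD(3)[OF rkhs_f \<sigma>, of "[]" v] that diag[OF that]
      by (simp add: gp_kernel.feature_dist2_def[OF gp])
    have conf: "\<bar>f v - post_mean k \<sigma> (queries i \<omega>) (observations i \<omega>) v\<bar>
        \<le> sqrt (bpe_beta \<Psi> (card X) ?B \<delta>) * post_sd k \<sigma> (queries i \<omega>) v"
      if i: "i \<in> {1..?B}" and v: "v \<in> X" for i v
    proof -
      have "queries i \<omega> \<in> ?Q i" using queries_subset[OF sp i] by simp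
      then have "\<omega> \<notin> miss_event c i v (queries i \<omega>)" using \<omega> i v by blast
      from confidence[OF \<sigma> sp i v this] show ?thesis by (simp add: beta)
    qed
    have "cum_regret X D \<xi> f xopt T (\<lambda>t. x t \<omega>) \<le> R"
      using robust_bpe_cum_regret_le[OF finite_X perturb_nonempty gp diag a T algorithm[OF sp] opt bounded conf] R
      by linarith
    then show "\<omega> \<in> {\<omega> \<in> space M. cum_regret X D \<xi> f xopt T (\<lambda>t. x t \<omega>) \<le> R}" using sp by simp
  qed
  moreover have "{\<omega> \<in> space M. cum_regret X D \<xi> f xopt T (\<lambda>t. x t \<omega>) \<le> R} \<in> events"
    using cum_regret_measurable[OF a] by measurable
  ultimately have "prob (space M - ?bad) \<le> prob {\<omega> \<in> space M. cum_regret X D \<xi> f xopt T (\<lambda>t. x t \<omega>) \<le> R}"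
    by (intro finite_measure_mono)
  then show ?thesis using prob_compl[OF bad] prob_bad by simp
qed

end


subsection \<open>Order of the regret\<close>

text \<open>The logarithm in \<open>\<beta>\<close> splits into \<open>ln (n / \<delta>)\<close> and
  \<open>ln B\<close>, and \<open>ln B \<le> 2 * ln (ln (ln T))\<close>. This is where the triple
  logarithm of the final bound comes from.\<close>

lemma sqrt_bpe_beta_le:
  assumes a: "0 < a" "a < 1" and T: "T \<ge> 1" and big: "ln (ln (real T)) \<ge> 4 + 1 / ln (1 / a)"
    and n: "n \<ge> 1" and \<delta>: "0 < \<delta>" "\<delta> < 1" and \<Psi>: "\<Psi> \<ge> 0"
  shows "sqrt (bpe_beta \<Psi> n (num_batches a T) \<delta>)
    \<le> 2 * (\<Psi> + sqrt (ln (real n / \<delta>)) + sqrt (ln (ln (ln (real T)))))"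
proof -
  let ?B = "real (num_batches a T)" and ?L = "ln (ln (ln (real T)))" and ?A = "ln (real n / \<delta>)"
  have "1 / ln (1 / a) > 0" using a by simp
  then have "ln (ln (real T)) \<ge> 1" using big by linarith
  then have L: "?L \<ge> 0" by simp
  have B: "?B \<ge> 1" using num_batches_ge_1[OF a T] by simp
  have "real n / \<delta> \<ge> 1" using n \<delta> by simp
  then have A: "?A \<ge> 0" by simp
  have "ln (real n * ?B / \<delta>) = ?A + ln ?B"
    using n B \<delta> by (simp add: ln_mult ln_div)
  then have "2 * ln (real n * ?B / \<delta>) \<le> 2 * ?A + 4 * ?L"
    using ln_num_batches_le[OF a T big] by simp
  also have "\<dots> \<le> (2 * (sqrt ?A + sqrt ?L))\<^sup>2"
    using A L by (simp add: power2_eq_square algebra_simps)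
  finally have "sqrt (2 * ln (real n * ?B / \<delta>)) \<le> 2 * (sqrt ?A + sqrt ?L)"
    using A L by (intro real_le_lsqrt) auto
  moreover have "0 \<le> ln (real n * ?B / \<delta>)"
    unfolding \<open>ln (real n * ?B / \<delta>) = ?A + ln ?B\<close> using A B by simp
  ultimately show ?thesis using \<Psi> by (simp add: bpe_beta_def)
qed

text \<open>Both parts of the theorem are instances, with \<open>g\<close> equal to
  \<open>sqrt \<gamma>\<close> at \<open>T\<close> or to \<open>sqrt (c' * \<alpha> T)\<close>. The
  \<open>4 * K\<close> comes from batch 1, via
  \<open>T powr (1 - a) \<le> T powr (1 - \<theta>)\<close> and \<open>1 \<le> K * g\<close>. The 16
  is 4 from the elimination bound, 2 from rounding batch sizes and 2 from
  \<open>s \<le> 2 * \<Lambda>\<close>.\<close>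

lemma regret_bound_order:
  fixes \<gamma> :: "nat \<Rightarrow> real"
  assumes a: "0 < a" "a < 1" "\<theta> < a" "0 \<le> \<theta>" and T: "T \<ge> 1"
    and s: "0 \<le> s" "s \<le> 2 * \<Lambda>" and \<Psi>: "0 \<le> \<Psi>" "\<Psi> \<le> \<Lambda>"
    and g: "0 \<le> g" "1 \<le> K * g" and K: "0 \<le> K" and V: "V \<ge> 0"
    and \<gamma>: "\<And>i. i \<in> {1..<num_batches a T} \<Longrightarrow>
      sqrt (\<gamma> (batch_size a T i) / real (batch_size a T i)) \<le> real (batch_size a T i) powr (- \<theta>) * g"
  shows "2 * \<Psi> * real (batch_size a T 1) + (\<Sum>i\<in>{1..<num_batches a T}. real (batch_size a T (Suc i)) *
      (4 * (s * sqrt (V * \<gamma> (batch_size a T i) / real (batch_size a T i)))))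
    \<le> (4 * K + 16 * sqrt V * (3 + 1 / ((a - \<theta>) * (1 - a)))) * \<Lambda> * (real T powr (1 - \<theta>) * g)"
proof -
  let ?N = "\<lambda>i. real (batch_size a T i)" and ?B = "num_batches a T"
  let ?G = "real T powr (1 - \<theta>) * g"
  let ?e = "\<lambda>i. exp (- ((a - \<theta>) * a ^ i * ln (real T)))"
  have T1: "real T \<ge> 1" using T by simp
  have \<Lambda>: "\<Lambda> \<ge> 0" using \<Psi> by simp
  have G: "?G \<ge> 0" using g by simp
  have "2 * \<Psi> * ?N 1 \<le> 2 * \<Psi> * (2 * real T powr (1 - a))"
    using batch_size_le[OF a(1,2) T, of 1] \<Psi> by (intro mult_left_mono) auto
  also have "\<dots> \<le> 2 * \<Psi> * (2 * (real T powr (1 - \<theta>) * (K * g)))"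
  proof -
    have "real T powr (1 - a) \<le> real T powr (1 - \<theta>)" using a T1 by (intro powr_mono) auto
    also have "\<dots> \<le> real T powr (1 - \<theta>) * (K * g)"
      using mult_left_mono[OF g(2), of "real T powr (1 - \<theta>)"] by simp
    finally show ?thesis using \<Psi> by (intro mult_left_mono) auto
  qed
  also have "\<dots> = \<Psi> * (4 * K * ?G)" by simp
  also have "\<dots> \<le> \<Lambda> * (4 * K * ?G)" using \<Psi> K G by (intro mult_right_mono) auto
  finally have first: "2 * \<Psi> * ?N 1 \<le> 4 * K * \<Lambda> * ?G" by (simp add: mult.commute mult.left_commute)
  have term_le: "?N (Suc i) * (4 * (s * sqrt (V * \<gamma> (batch_size a T i) / ?N i)))
      \<le> 16 * sqrt V * \<Lambda> * ?G * ?e i" if i: "i \<in> {1..<?B}" for i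
  proof -
    have Ni: "real T powr (1 - a ^ i) \<le> ?N i" using i by (intro batch_size_inner_ge[OF a(1,2) T]) auto
    have "?N i powr (- \<theta>) \<le> (real T powr (1 - a ^ i)) powr (- \<theta>)"
      using Ni T1 a by (intro powr_mono2') auto
    then have "sqrt (\<gamma> (batch_size a T i) / ?N i) \<le> (real T powr (1 - a ^ i)) powr (- \<theta>) * g"
      using \<gamma>[OF i] mult_right_mono[OF _ g(1)] order_trans by blast
    then have "?N (Suc i) * sqrt (\<gamma> (batch_size a T i) / ?N i)
        \<le> (2 * real T powr (1 - a ^ Suc i)) * ((real T powr (1 - a ^ i)) powr (- \<theta>) * g)"
      using batch_size_le[OF a(1,2) T, of "Suc i"] g(1)
      by (meson mult_mono mult_left_mono order_trans of_nat_0_le_iff mult_right_mono mult_nonneg_nonneg powr_ge_zero)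
    also have "\<dots> = 2 * (real T powr ((1 - a ^ Suc i) + (1 - a ^ i) * (- \<theta>)) * g)"
      by (simp only: powr_powr powr_add mult.assoc)
    \<comment> \<open>The batch sizes are designed for this identity: the leading exponent no longer
      depends on \<open>i\<close>, and \<open>\<theta> < a\<close> makes the remaining factor
      decaying.\<close>
    also have "(1 - a ^ Suc i) + (1 - a ^ i) * (- \<theta>) = (1 - \<theta>) + - ((a - \<theta>) * a ^ i)"
      by (simp add: algebra_simps)
    also have "real T powr \<dots> = real T powr (1 - \<theta>) * ?e i"
    proof -
      have "real T powr (- ((a - \<theta>) * a ^ i)) = ?e i" using T1 by (simp add: powr_def)
      then show ?thesis by (simp only: powr_add)
    qed
    finally have main: "?N (Suc i) * sqrt (\<gamma> (batch_size a T i) / ?N i) \<le> 2 * ?G * ?e i"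
      by (simp add: mult_ac)
    have "?N (Suc i) * (4 * (s * sqrt (V * \<gamma> (batch_size a T i) / ?N i)))
        = (4 * s * sqrt V) * (?N (Suc i) * sqrt (\<gamma> (batch_size a T i) / ?N i))"
      by (simp add: real_sqrt_mult real_sqrt_divide)
    also have "\<dots> \<le> (4 * s * sqrt V) * (2 * ?G * ?e i)"
      using main s V by (intro mult_left_mono) auto
    also have "\<dots> \<le> (4 * (2 * \<Lambda>) * sqrt V) * (2 * ?G * ?e i)"
      using s V g(1) by (intro mult_right_mono mult_nonneg_nonneg) auto
    finally show ?thesis by (simp add: mult_ac)
  qed
  have "(\<Sum>i\<in>{1..<?B}. ?N (Suc i) * (4 * (s * sqrt (V * \<gamma> (batch_size a T i) / ?N i))))
      \<le> (\<Sum>i\<in>{1..<?B}. 16 * sqrt V * \<Lambda> * ?G * ?e i)"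
    using term_le by (rule sum_mono)
  also have "\<dots> = 16 * sqrt V * \<Lambda> * ?G * (\<Sum>i\<in>{1..<?B}. ?e i)" by (rule sum_distrib_left[symmetric])
  also have "\<dots> \<le> 16 * sqrt V * \<Lambda> * ?G * (3 + 1 / ((a - \<theta>) * (1 - a)))"
    using sum_exp_neg_le[OF a(1,2) T, of "a - \<theta>"] a V \<Lambda> g(1) by (intro mult_left_mono mult_nonneg_nonneg) auto
  finally show ?thesis using first by (simp add: algebra_simps)
qed

lemma (in robust_bpe_run) cum_regret_order_whp:
  assumes \<sigma>: "\<sigma> > 0" and a: "0 < a" "a < 1" "\<theta> < a" "0 \<le> \<theta>" and T: "T \<ge> 1"
    and big: "ln (ln (real T)) \<ge> 4 + 1 / ln (1 / a)" and \<delta>: "\<delta> \<in> {0<..<1}"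
    and diag: "\<And>v. v \<in> X \<Longrightarrow> k v v = 1" and opt: "robust_optimal X D \<xi> f xopt"
    and g: "0 \<le> g" "1 \<le> K * g" and K: "0 \<le> K"
    and \<gamma>: "\<And>i. i \<in> {1..<num_batches a T} \<Longrightarrow>
      sqrt (max_info_gain k \<sigma> X (batch_size a T i) / real (batch_size a T i))
      \<le> real (batch_size a T i) powr (- \<theta>) * g"
    and G: "G = real T powr (1 - \<theta>) * g"
  shows "1 - \<delta> \<le> prob {\<omega> \<in> space M. cum_regret X D \<xi> f xopt T (\<lambda>t. x t \<omega>)
    \<le> (4 * K + 16 * sqrt (2 * (\<sigma>\<^sup>2 + 1)) * (3 + 1 / ((a - \<theta>) * (1 - a))))
      * ((\<Psi> + sqrt (ln (real (card X) / \<delta>))) + sqrt (ln (ln (ln (real T))))) * G}"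
proof -
  have \<Psi>: "\<Psi> \<ge> 0" by (rule rkhs_norm_leD(2)[OF rkhs_f \<sigma>])
  have n: "card X \<ge> 1" using finite_X nonempty_X by (simp add: Suc_leI card_gt_0_iff)
  have d: "0 < \<delta>" "\<delta> < 1" using \<delta> by auto
  have "1 / ln (1 / a) > 0" using a by simp
  then have "ln (ln (real T)) \<ge> 1" using big by linarith
  then have L: "ln (ln (ln (real T))) \<ge> 0" by simp
  have "real (card X) / \<delta> \<ge> 1" using n d by simp
  then have A: "ln (real (card X) / \<delta>) \<ge> 0" by simp
  show ?thesis unfolding G
    by (rule cum_regret_whp[OF \<sigma> a(1,2) T d diag opt],
        assumption, rule regret_bound_order[OF a T _ sqrt_bpe_beta_le[OF a(1,2) T big n d \<Psi>] \<Psi> _ g K _ \<gamma>])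
      (use A L in \<open>auto simp: bpe_beta_def\<close>)
qed

lemma eventually_ln_ln_ge: "eventually (\<lambda>T. ln (ln (real T)) \<ge> c \<and> ln (real T) \<ge> d \<and> T \<ge> t) sequentially"
proof -
  have 1: "filterlim (\<lambda>T. ln (real T)) at_top sequentially"
    by (rule filterlim_compose[OF ln_at_top filterlim_real_sequentially])
  have 2: "filterlim (\<lambda>T. ln (ln (real T))) at_top sequentially"
    by (rule filterlim_compose[OF ln_at_top 1])
  show ?thesis
    using 1 2 unfolding filterlim_at_top by (intro eventually_conj eventually_ge_at_top) auto
qed

theorem theorem3:
  fixes l \<Psi> \<sigma> \<xi> :: real
  assumes "l > 0" and "\<sigma> > 0"
  shows
    "(\<forall>(k :: real ^ 'd \<Rightarrow> real ^ 'd \<Rightarrow> real) a.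
        (k = se_kernel l \<or> (\<exists>\<nu>>0. k = matern_kernel \<nu> l)) \<and> 1 / 2 < a \<and> a < 1 \<longrightarrow>
        (\<exists>C>0. \<exists>T0. \<forall>T\<ge>T0. \<forall>\<delta>\<in>{0<..<1}.
           \<forall>(M :: 'w measure) X D f F z x u xopt.
             robust_bpe_run M X k D \<xi> \<Psi> \<sigma> a T \<delta> f F z x u \<and> robust_optimal X D \<xi> f xopt \<longrightarrow>
             measure M {\<omega> \<in> space M.
               cum_regret X D \<xi> f xopt T (\<lambda>t. x t \<omega>)
                 \<le> C * ((\<Psi> + sqrt (ln (real (card X) / \<delta>))) + sqrt (ln (ln (ln (real T)))))
                     * sqrt (real T * max_info_gain k \<sigma> X T)} \<ge> 1 - \<delta>))
     \<and>
     (\<forall>\<nu> a c' (\<alpha> :: nat \<Rightarrow> real) (gbar :: nat \<Rightarrow> real) t0.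
        \<nu> > 0 \<and> \<nu> / (2 * \<nu> + real CARD('d)) < a \<and> a \<le> 1 / 2 \<and>
        c' > 0 \<and> mono_on {1..} \<alpha> \<and>
        (\<forall>t\<ge>1. gbar t = c' * real t powr (real CARD('d) / (2 * \<nu> + real CARD('d))) * \<alpha> t) \<longrightarrow>
        (\<exists>C>0. \<exists>T0. \<forall>T\<ge>T0. \<forall>\<delta>\<in>{0<..<1}.
           \<forall>(M :: 'w measure) (X :: (real ^ 'd) set) D f F z x u xopt.
             robust_bpe_run M X (matern_kernel \<nu> l) D \<xi> \<Psi> \<sigma> a T \<delta> f F z x u \<and>
             robust_optimal X D \<xi> f xopt \<and>
             (\<forall>t\<ge>t0. max_info_gain (matern_kernel \<nu> l) \<sigma> X t \<le> gbar t) \<longrightarrow>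
             measure M {\<omega> \<in> space M.
               cum_regret X D \<xi> f xopt T (\<lambda>t. x t \<omega>)
                 \<le> C * ((\<Psi> + sqrt (ln (real (card X) / \<delta>))) + sqrt (ln (ln (ln (real T)))))
                     * sqrt (real T * gbar T)} \<ge> 1 - \<delta>))"
proof (intro conjI allI impI; elim conjE)
  \<comment> \<open>The information of one observation. It bounds \<open>\<gamma>\<close> at
    \<open>T\<close> from below, whence \<open>K = 1 / sqrt \<kappa>\<close> in the first
    part.\<close>
  define \<kappa> where "\<kappa> = 1 / 2 * ln (1 + 1 / \<sigma>\<^sup>2)"
  have "1 + 1 / \<sigma>\<^sup>2 > 1" using assms(2) by simp
  from ln_gt_zero[OF this] have \<kappa>: "\<kappa> > 0" by (simp add: \<kappa>_def)
  define V where "V = sqrt (2 * (\<sigma>\<^sup>2 + 1))"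
  have V: "V > 0" by (simp add: V_def add_nonneg_pos)
  {
    fix k :: "real ^ 'd \<Rightarrow> real ^ 'd \<Rightarrow> real" and a :: real
    assume kern: "k = se_kernel l \<or> (\<exists>\<nu>>0. k = matern_kernel \<nu> l)" and a: "1 / 2 < a" "a < 1"
    have diag: "k v v = 1" for v using kern by (auto simp: se_kernel_def matern_kernel_def)
    let ?K = "1 / sqrt \<kappa>"
    define C where "C = 4 * ?K + 16 * V * (3 + 1 / ((a - 1 / 2) * (1 - a)))"
    have C: "C > 0" using \<kappa> V a by (simp add: C_def add_pos_pos)
    obtain T0 where T0: "\<And>T. T \<ge> T0 \<Longrightarrow> ln (ln (real T)) \<ge> 4 + 1 / ln (1 / a) \<and> ln (real T) \<ge> 0 \<and> T \<ge> 1"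
      using eventually_ln_ln_ge[of "4 + 1 / ln (1 / a)" 0 1] unfolding eventually_sequentially by blast
    have "1 - \<delta> \<le> measure M {\<omega> \<in> space M. cum_regret X D \<xi> f xopt T (\<lambda>t. x t \<omega>)
        \<le> C * ((\<Psi> + sqrt (ln (real (card X) / \<delta>))) + sqrt (ln (ln (ln (real T)))))
          * sqrt (real T * max_info_gain k \<sigma> X T)}"
      if T: "T \<ge> T0" and \<delta>: "\<delta> \<in> {0<..<1}" and run: "robust_bpe_run M X k D \<xi> \<Psi> \<sigma> a T \<delta> f F z x u"
        and opt: "robust_optimal X D \<xi> f xopt"
      for T \<delta> and M :: "'w measure" and X D f F z x u xopt
    proof -
      interpret robust_bpe_run M X k D \<xi> \<Psi> \<sigma> a T \<delta> f F z x u by (rule run)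
      interpret K: gp_kernel X k \<sigma> by (rule rkhs_norm_leD(1)[OF rkhs_f assms(2)])
      let ?\<gamma> = "max_info_gain k \<sigma> X"
      have T1: "T \<ge> 1" and big: "ln (ln (real T)) \<ge> 4 + 1 / ln (1 / a)" using T0[OF T] by auto
      have gT: "\<kappa> \<le> ?\<gamma> T"
        unfolding \<kappa>_def by (rule K.max_info_gain_lower[OF finite_X nonempty_X T1 diag])
      have G: "sqrt (real T * ?\<gamma> T) = real T powr (1 - 1 / 2) * sqrt (?\<gamma> T)"
        using T1 by (simp add: real_sqrt_mult powr_half_sqrt)
      have Kg: "1 \<le> ?K * sqrt (?\<gamma> T)" using \<kappa> gT by simp
      have \<gamma>: "sqrt (?\<gamma> (batch_size a T i) / real (batch_size a T i))
          \<le> real (batch_size a T i) powr (- (1 / 2)) * sqrt (?\<gamma> T)" for i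
      proof -
        have "?\<gamma> (batch_size a T i) \<le> ?\<gamma> T"
          using batch_size_le_T by (rule K.max_info_gain_mono[OF finite_X nonempty_X])
        then have "sqrt (?\<gamma> (batch_size a T i) / real (batch_size a T i)) \<le> sqrt (?\<gamma> T / real (batch_size a T i))"
          by (intro real_sqrt_le_mono divide_right_mono) auto
        also have "\<dots> = real (batch_size a T i) powr (- (1 / 2)) * sqrt (?\<gamma> T)"
          by (simp add: real_sqrt_divide powr_minus_divide powr_half_sqrt)
        finally show ?thesis .
      qed
      show ?thesis
        unfolding C_def V_def
        by (rule cum_regret_order_whp[OF assms(2) _ a(2) a(1) _ T1 big \<delta> diag opt _ Kg _ \<gamma> G])
          (use a \<kappa> gT in auto)
    qed
    then show "\<exists>C>0. \<exists>T0. \<forall>T\<ge>T0. \<forall>\<delta>\<in>{0<..<1}.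
           \<forall>(M :: 'w measure) X D f F z x u xopt.
             robust_bpe_run M X k D \<xi> \<Psi> \<sigma> a T \<delta> f F z x u \<and> robust_optimal X D \<xi> f xopt \<longrightarrow>
             measure M {\<omega> \<in> space M.
               cum_regret X D \<xi> f xopt T (\<lambda>t. x t \<omega>)
                 \<le> C * ((\<Psi> + sqrt (ln (real (card X) / \<delta>))) + sqrt (ln (ln (ln (real T)))))
                     * sqrt (real T * max_info_gain k \<sigma> X T)} \<ge> 1 - \<delta>"
      using C by blast
  }
  {
    fix \<nu> a c' :: real and \<alpha> gbar :: "nat \<Rightarrow> real" and t0 :: nat
    assume \<nu>: "\<nu> > 0" and a: "\<nu> / (2 * \<nu> + real CARD('d)) < a" "a \<le> 1 / 2" and c': "c' > 0"
      and \<alpha>: "mono_on {1..} \<alpha>"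
      and gbar: "\<forall>t\<ge>1. gbar t = c' * real t powr (real CARD('d) / (2 * \<nu> + real CARD('d))) * \<alpha> t"
    let ?k = "matern_kernel \<nu> l :: real ^ 'd \<Rightarrow> real ^ 'd \<Rightarrow> real"
    define d where "d = real CARD('d)"
    have d: "d > 0" by (simp add: d_def)
    \<comment> \<open>If the information gain grows like \<open>t powr p\<close> with
      \<open>p = 1 - 2 * \<theta>\<close>, the width \<open>sqrt (t powr p / t)\<close> decays like
      \<open>t powr (- \<theta>)\<close>.\<close>
    define \<theta> where "\<theta> = \<nu> / (2 * \<nu> + d)"
    define p where "p = d / (2 * \<nu> + d)"
    have \<theta>: "0 < \<theta>" using \<nu> d by (simp add: \<theta>_def)
    have a': "\<theta> < a" using a(1) by (simp add: \<theta>_def d_def)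
    have p: "p = 1 - 2 * \<theta>" using \<nu> d by (simp add: p_def \<theta>_def field_simps)
    have gbar': "gbar t = c' * real t powr p * \<alpha> t" if "t \<ge> 1" for t
      using gbar that by (simp add: p_def d_def)
    \<comment> \<open>From \<open>t1\<close> on, both the domination of \<open>\<gamma>\<close> by
      \<open>gbar\<close> and the product form of \<open>gbar\<close> are available.\<close>
    define t1 where "t1 = max t0 1"
    \<comment> \<open>A lower bound for \<open>c' * \<alpha> T\<close>: by monotonicity of
      \<open>\<alpha>\<close> it is at least \<open>c' * \<alpha> t1\<close>, which is
      \<open>gbar t1 / t1 powr p\<close>, and \<open>gbar t1\<close> is at least
      \<open>\<kappa>\<close>. The value does not depend on \<open>X\<close> or \<open>f\<close>,
      and it also makes \<open>\<alpha> T\<close> positive.\<close>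
    define \<kappa>' where "\<kappa>' = \<kappa> / real t1 powr p"
    have t1: "t1 \<ge> 1" "t1 \<ge> t0" by (auto simp: t1_def)
    have \<kappa>': "\<kappa>' > 0" using \<kappa> t1 by (simp add: \<kappa>'_def)
    let ?K = "1 / sqrt \<kappa>'"
    define C where "C = 4 * ?K + 16 * V * (3 + 1 / ((a - \<theta>) * (1 - a)))"
    have C: "C > 0" using \<kappa>' V a a' by (simp add: C_def add_pos_pos)
    \<comment> \<open>The second condition says \<open>T powr (1 - a) \<ge> t1\<close>, so that
      every batch before the last is long enough for \<open>gbar\<close> to dominate the information
      gain at its size.\<close>
    obtain T0 where T0: "\<And>T. T \<ge> T0 \<Longrightarrow>
        ln (ln (real T)) \<ge> 4 + 1 / ln (1 / a) \<and> ln (real T) \<ge> ln (real t1) / (1 - a) \<and> T \<ge> t1"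
      using eventually_ln_ln_ge[of "4 + 1 / ln (1 / a)" "ln (real t1) / (1 - a)" t1]
      unfolding eventually_sequentially by blast
    have "1 - \<delta> \<le> measure M {\<omega> \<in> space M. cum_regret X D \<xi> f xopt T (\<lambda>t. x t \<omega>)
        \<le> C * ((\<Psi> + sqrt (ln (real (card X) / \<delta>))) + sqrt (ln (ln (ln (real T)))))
          * sqrt (real T * gbar T)}"
      if T: "T \<ge> T0" and \<delta>: "\<delta> \<in> {0<..<1}" and run: "robust_bpe_run M X ?k D \<xi> \<Psi> \<sigma> a T \<delta> f F z x u"
        and opt: "robust_optimal X D \<xi> f xopt" and bar: "\<forall>t\<ge>t0. max_info_gain ?k \<sigma> X t \<le> gbar t"
      for T \<delta> and M :: "'w measure" and X D f F z x u xopt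
    proof -
      interpret robust_bpe_run M X ?k D \<xi> \<Psi> \<sigma> a T \<delta> f F z x u by (rule run)
      interpret K: gp_kernel X ?k \<sigma> by (rule rkhs_norm_leD(1)[OF rkhs_f assms(2)])
      let ?\<gamma> = "max_info_gain ?k \<sigma> X"
      have diag: "?k v v = 1" for v by (simp add: matern_kernel_def)
      have a0: "0 < a" "a < 1" using a a' \<theta> by auto
      have Tt1: "T \<ge> t1" and T1: "T \<ge> 1" and big: "ln (ln (real T)) \<ge> 4 + 1 / ln (1 / a)"
        using T0[OF T] t1 by auto
      have "\<kappa> \<le> ?\<gamma> t1"
        unfolding \<kappa>_def by (rule K.max_info_gain_lower[OF finite_X nonempty_X t1(1) diag])
      also have "\<dots> \<le> c' * real t1 powr p * \<alpha> t1" using bar t1 gbar' by auto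
      finally have "\<kappa>' \<le> c' * \<alpha> t1" using t1 by (simp add: \<kappa>'_def field_simps)
      also have "\<dots> \<le> c' * \<alpha> T" using mono_onD[OF \<alpha> _ _ Tt1] t1 T1 c' by simp
      finally have \<alpha>T: "\<kappa>' \<le> c' * \<alpha> T" .
      have sqrt_T: "sqrt (real t powr p * real t) = real t powr (1 - \<theta>)" if "t \<ge> 1" for t
      proof -
        have "real t powr p * real t = real t powr (1 + p)"
          by (simp add: powr_mult_base mult.commute)
        also have "1 + p = 2 * (1 - \<theta>)" by (simp add: p)
        also have "real t powr \<dots> = (real t powr (1 - \<theta>))\<^sup>2"
          by (simp add: power2_eq_square powr_add[symmetric])
        finally show ?thesis by simp
      qed
      have G: "sqrt (real T * gbar T) = real T powr (1 - \<theta>) * sqrt (c' * \<alpha> T)"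
        unfolding gbar'[OF T1] sqrt_T[OF T1, symmetric] real_sqrt_mult[symmetric] by (simp add: mult_ac)
      have Kg: "1 \<le> ?K * sqrt (c' * \<alpha> T)" using \<kappa>' \<alpha>T by simp
      have \<gamma>: "sqrt (?\<gamma> (batch_size a T i) / real (batch_size a T i))
          \<le> real (batch_size a T i) powr (- \<theta>) * sqrt (c' * \<alpha> T)" if i: "i \<in> {1..<num_batches a T}" for i
      proof -
        let ?N = "batch_size a T i"
        have iB: "1 \<le> i" "i < num_batches a T" using i by auto
        have "ln (real t1) \<le> (1 - a) * ln (real T)" using T0[OF T] a0 by (simp add: field_simps)
        then have "exp (ln (real t1)) \<le> exp ((1 - a) * ln (real T))" by simp
        then have "real t1 \<le> real T powr (1 - a)" using t1 T1 by (simp add: powr_def)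
        also have "\<dots> \<le> real T powr (1 - a ^ i)"
          using T1 a0 iB power_decreasing[of 1 i a] by (intro powr_mono) auto
        also have "\<dots> \<le> real ?N" by (rule batch_size_inner_ge[OF a0 T1 iB])
        finally have N: "t1 \<le> ?N" by simp
        then have N1: "1 \<le> ?N" using t1 by simp
        have "?\<gamma> ?N \<le> gbar ?N" using bar N t1 by auto
        also have "\<dots> = c' * real ?N powr p * \<alpha> ?N" using N1 by (rule gbar')
        also have "\<dots> \<le> c' * real ?N powr p * \<alpha> T"
          using mono_onD[OF \<alpha> _ _ batch_size_le_T[of a T i]] N1 T1 c' by (intro mult_left_mono) auto
        finally have "?\<gamma> ?N / real ?N \<le> (c' * real ?N powr p * \<alpha> T) / real ?N"
          by (rule divide_right_mono) simp
        also have "\<dots> = (real ?N powr (- \<theta>))\<^sup>2 * (c' * \<alpha> T)"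
        proof -
          have "real ?N powr p / real ?N = real ?N powr (p - 1)" using N1 by (simp add: powr_diff)
          also have "p - 1 = - \<theta> + - \<theta>" by (simp add: p)
          also have "real ?N powr \<dots> = (real ?N powr (- \<theta>))\<^sup>2"
            by (simp only: powr_add power2_eq_square)
          finally have "(real ?N powr (- \<theta>))\<^sup>2 = real ?N powr p / real ?N" by simp
          then show ?thesis by simp
        qed
        finally have "sqrt (?\<gamma> ?N / real ?N) \<le> sqrt ((real ?N powr (- \<theta>))\<^sup>2 * (c' * \<alpha> T))"
          by (rule real_sqrt_le_mono)
        then show ?thesis by (simp add: real_sqrt_mult)
      qed
      show ?thesis
        unfolding C_def V_def
        by (rule cum_regret_order_whp[OF assms(2) a0 a' _ T1 big \<delta> diag opt _ Kg _ \<gamma> G])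
          (use \<theta> \<kappa>' \<alpha>T in auto)
    qed
    then show "\<exists>C>0. \<exists>T0. \<forall>T\<ge>T0. \<forall>\<delta>\<in>{0<..<1}.
           \<forall>(M :: 'w measure) (X :: (real ^ 'd) set) D f F z x u xopt.
             robust_bpe_run M X (matern_kernel \<nu> l) D \<xi> \<Psi> \<sigma> a T \<delta> f F z x u \<and>
             robust_optimal X D \<xi> f xopt \<and>
             (\<forall>t\<ge>t0. max_info_gain (matern_kernel \<nu> l) \<sigma> X t \<le> gbar t) \<longrightarrow>
             measure M {\<omega> \<in> space M.
               cum_regret X D \<xi> f xopt T (\<lambda>t. x t \<omega>)
                 \<le> C * ((\<Psi> + sqrt (ln (real (card X) / \<delta>))) + sqrt (ln (ln (ln (real T)))))
                     * sqrt (real T * gbar T)} \<ge> 1 - \<delta>"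
      using C by blast
  }
qed

end
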